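(* Let $\eta_0,\eta_\infty,\kappa_0,\kappa_\infty\in\mathbb{C}$ with $\eta_0\eta_\infty\neq0$, and consider the Hamiltonian system $y_3'=\partial H/\partial z_3$, $z_3'=-\partial H/\partial y_3$ with the Okamoto Hamiltonian $$H(y_3,z_3;x)=\frac1x\Big(2y_3^2z_3^2+\eta_\infty(\kappa_0+\kappa_\infty)\,x\,y_3-z_3\big(2\eta_\infty x\,y_3^2-2\eta_0x+(2\kappa_0+1)y_3\big)\Big).$$ Let $q=q(x)$ be a solution of $(\mathrm{P}_{\mathrm{III}},D_6)$ with parameters $\alpha=-4\eta_\infty\kappa_\infty$, $\beta=4\eta_0(\kappa_0+1)$, $\gamma=4\eta_\infty^2$, $\delta=-4\eta_0^2$. Applying to this system the transformation $(y_3,z_3)\mapsto(y,z)$ defined by $$y_3=z+q,\qquad z_3=yz+\frac{x\,\eta_\infty}{2}+\frac{x(q'-2\eta_0)}{4q^2}+\frac{2\kappa_0+1}{4q}$$ gives rise to the system $$\begin{cases}\begin{aligned} y'&=\left(3\,\frac{yz}{q^2}+4\,\frac{y}{q}+\frac{1+2\kappa_0}{2q^3}\right)(2\eta_0-q')+x\left(\eta_\infty^2-\frac{\eta_0^2}{q^4}\right)+\frac{x\,q'}{4q^4}(4\eta_0-q')\\ &\quad-\left(3\,\frac{yz}{xq}+2\,\frac{y}{x}\right)(1+2\kappa_0)-\frac{(1+2\kappa_0)^2}{4xq^2}-\frac{4y^2}{x}\left(3zq+q^2+2z^2\right),\end{aligned}\\[4ex] z'=\dfrac{z}{x}\left(\left(\dfrac{z}{q}+1\right)(1+2\kappa_0)+4y(z+q)^2\right)-\left(\dfrac{z^2}{q^2}+\dfrac{2z}{q}\right)(2\eta_0-q'),\end{cases}$$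 and this system is Bureau-Guillot for $(\mathrm{P}_{\mathrm{III}},D_6)$.
   Context: The independent variable is $x\in\mathbb{C}$ and $'=d/dx$. The third Painlevé equation of type $D_6$ is $$(\mathrm{P}_{\mathrm{III}},D_6)\colon\ y''=\frac{(y')^2}{y}-\frac{y'}{x}+\frac{\alpha y^2+\beta}{x}+\gamma y^3+\frac{\delta}{y},\qquad \gamma\delta\neq0.$$ The Hamiltonian system with coefficients rational in $x$ associated with $(\mathrm{P}_{\mathrm{III}},D_6)$ is the one with the Hamiltonian $H$ in the claim (its component $y_3$ satisfies this equation with the stated parameters). Regularisation process. A system $y'=P(y,z;x)$, $z'=Q(y,z;x)$, with $P,Q$ rational in $(y,z)$ and coefficients depending on $x$, is extended to $\mathbb{P}^2$, covered by the affine charts $(y,z)$, $(u_0,v_0)$, $(U_0,V_0)$ with $[1:y:z]=[u_0:1:v_0]=[V_0:U_0:1]$. In each chart one looks for base points, i.e. points where the right-hand side of one of the (rational) equations becomes $0/0$. Each base point (in a chart $(y,z)$, at $(a,b)$) is blown up, by introducing the charts $u=y-a$, $v=\frac{z-b}{y-a}$ and $U=\frac{y-a}{z-b}$, $V=z-b$, with exceptional curve $\{u=0\}\cup\{V=0\}$; new base points on it are blown up again, which gives for each base point one or more finite sequences ("cascades") of blow-ups, until no indeterminacy is left in the final charts. The system is regularised if in every cascade it is regular on the last exceptional curve in one of the final charts. The regularising conditions are the (differential) constraints on the coefficient functions of the system which make it regular on the last exceptional curves in this sense. Definition. A system $y'=P(y,z;x)$, $z'=Q(y,z;x)$ is an analogue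 of the Bureau-Guillot system (Bureau-Guillot, for short) for $(\mathrm{P}_{\mathrm J})$ if: (i) it is birationally equivalent (by a transformation of $(y,z)$ with coefficients depending on $x$) to the Hamiltonian system with coefficients rational in $x$ associated with $(\mathrm{P}_{\mathrm J})$; (ii) it has coefficient functions both rational and meromorphic in $x$ which are functions of the Painlevé transcendent $\mathrm{P}_{\mathrm J}$ (here $q$) and its derivatives; (iii) the Painlevé equation $(\mathrm{P}_{\mathrm J})$ is obtained as a regularising condition in the regularisation process of the system, i.e., regarding $q$ as an a priori undetermined function, the regularising conditions are differential equations for $q$ that are satisfied when $q$ solves $(\mathrm{P}_{\mathrm J})$. *)

theory Defs
  imports "HOL-Complex_Analysis.Complex_Analysis"
begin

section \<open>Second-order equations and planar systems\<close>

text \<open>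
  An equation \<open>y'' = R(x, y, y')\<close> comes with the set \<open>A\<close> of pairs \<open>(x, y)\<close> at which its right-hand
  side is defined. Solutions are meromorphic functions on a domain; the equation is imposed at the
  points where the function is analytic and takes an admissible value. (Values of a meromorphic
  function at its poles carry no information.)
\<close>

definition regular_set :: "(complex \<times> complex) set \<Rightarrow> complex set \<Rightarrow> (complex \<Rightarrow> complex) \<Rightarrow> complex set"
  where "regular_set A D q = {x \<in> D. q analytic_on {x} \<and> (x, q x) \<in> A}"

definition solution_of ::
    "(complex \<times> complex) set \<Rightarrow> (complex \<Rightarrow> complex \<Rightarrow> complex \<Rightarrow> complex) \<Rightarrow>
     complex set \<Rightarrow> (complex \<Rightarrow> complex) \<Rightarrow> bool"
  where "solution_of A R D q \<longleftrightarrow>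
    open D \<and> connected D \<and> q meromorphic_on D \<and> regular_set A D q \<noteq> {} \<and>
    (\<forall>x\<in>regular_set A D q. deriv (deriv q) x = R x (q x) (deriv q x))"

definition P3D6_dom :: "(complex \<times> complex) set"
  where "P3D6_dom = {(x, y). x \<noteq> 0 \<and> y \<noteq> 0}"

definition P3D6_rhs ::
    "complex \<Rightarrow> complex \<Rightarrow> complex \<Rightarrow> complex \<Rightarrow> complex \<Rightarrow> complex \<Rightarrow> complex \<Rightarrow> complex"
  where "P3D6_rhs \<alpha> \<beta> \<gamma> \<delta> x y y1 =
    y1\<^sup>2 / y - y1 / x + (\<alpha> * y\<^sup>2 + \<beta>) / x + \<gamma> * y ^ 3 + \<delta> / y"

text \<open>A system \<open>y' = P(y, z; x)\<close>, \<open>z' = Q(y, z; x)\<close> is the map \<open>x y z \<mapsto> (P, Q)\<close>.\<close>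

type_synonym planar_system = "complex \<Rightarrow> complex \<Rightarrow> complex \<Rightarrow> complex \<times> complex"

definition solves :: "planar_system \<Rightarrow> complex set \<Rightarrow> (complex \<Rightarrow> complex) \<Rightarrow> (complex \<Rightarrow> complex) \<Rightarrow> bool"
  where "solves S W y z \<longleftrightarrow>
    (\<forall>x\<in>W. (y has_field_derivative fst (S x (y x) (z x))) (at x) \<and>
           (z has_field_derivative snd (S x (y x) (z x))) (at x))"

definition hamiltonian_system :: "(complex \<Rightarrow> complex \<Rightarrow> complex \<Rightarrow> complex) \<Rightarrow> planar_system"
  where "hamiltonian_system H = (\<lambda>x y z. (deriv (\<lambda>w. H x y w) z, - deriv (\<lambda>w. H x w z) y))"


section \<open>Rational functions of two variables\<close>

text \<open>In \<open>N :: complex poly poly\<close> the outer variable is \<open>z\<close> and the coefficients are polynomials in \<open>y\<close>.\<close>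

definition eval2 :: "complex poly poly \<Rightarrow> complex \<Rightarrow> complex \<Rightarrow> complex"
  where "eval2 N y z = poly (poly N [:z:]) y"

text \<open>
  A rational function is represented by a total function that agrees with it off some algebraic
  curve, so that the values which \<open>_ / 0 = 0\<close> produces on the curve are irrelevant. Indeterminacy
  and regularity refer to the fraction in lowest terms, which is unique up to a constant factor.
\<close>

definition lowest_terms ::
    "(complex \<Rightarrow> complex \<Rightarrow> complex) \<Rightarrow> complex poly poly \<Rightarrow> complex poly poly \<Rightarrow> bool"
  where "lowest_terms f N M \<longleftrightarrow> M \<noteq> 0 \<and> coprime N M \<and>
    (\<exists>E. E \<noteq> 0 \<and> (\<forall>y z. eval2 E y z \<noteq> 0 \<longrightarrow> f y z = eval2 N y z / eval2 M y z))"

definition indeterminate_at :: "(complex \<Rightarrow> complex \<Rightarrow> complex) \<Rightarrow> complex \<Rightarrow> complex \<Rightarrow> bool"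
  where "indeterminate_at f y z \<longleftrightarrow>
    (\<exists>N M. lowest_terms f N M \<and> eval2 N y z = 0 \<and> eval2 M y z = 0)"

definition regular_at :: "(complex \<Rightarrow> complex \<Rightarrow> complex) \<Rightarrow> complex \<Rightarrow> complex \<Rightarrow> bool"
  where "regular_at f y z \<longleftrightarrow> (\<exists>N M. lowest_terms f N M \<and> eval2 M y z \<noteq> 0)"

definition base_points :: "planar_system \<Rightarrow> complex \<Rightarrow> (complex \<times> complex) set"
  where "base_points S x = {(y, z).
    indeterminate_at (\<lambda>y z. fst (S x y z)) y z \<or> indeterminate_at (\<lambda>y z. snd (S x y z)) y z}"

definition regular_points :: "planar_system \<Rightarrow> complex \<Rightarrow> (complex \<times> complex) set"
  where "regular_points S x = {(y, z).
    regular_at (\<lambda>y z. fst (S x y z)) y z \<and> regular_at (\<lambda>y z. snd (S x y z)) y z}"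


section \<open>The regularisation process\<close>

text \<open>
  The system in the charts of the projective plane with \<open>[1 : y : z] = [u\<^sub>0 : 1 : v\<^sub>0] = [V\<^sub>0 : U\<^sub>0 : 1]\<close>,
  that is \<open>u\<^sub>0 = 1/y\<close>, \<open>v\<^sub>0 = z/y\<close> and \<open>U\<^sub>0 = y/z\<close>, \<open>V\<^sub>0 = 1/z\<close>.
\<close>

definition chart_u0v0 :: "planar_system \<Rightarrow> planar_system"
  where "chart_u0v0 S = (\<lambda>x u v.
    case S x (1 / u) (v / u) of (P, Q) \<Rightarrow> (- (u\<^sup>2) * P, u * (Q - v * P)))"

definition chart_U0V0 :: "planar_system \<Rightarrow> planar_system"
  where "chart_U0V0 S = (\<lambda>x U V.
    case S x (U / V) (1 / V) of (P, Q) \<Rightarrow> (V * (P - U * Q), - (V\<^sup>2) * Q))"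

text \<open>
  The system in the two charts of the blow-up of the moving point \<open>(a(x), b(x))\<close>:
  \<open>y = a + u\<close>, \<open>z = b + u v\<close>, with exceptional curve \<open>u = 0\<close>, and \<open>y = a + U V\<close>, \<open>z = b + V\<close>,
  with exceptional curve \<open>V = 0\<close>.
\<close>

definition blowup_uv :: "(complex \<Rightarrow> complex) \<Rightarrow> (complex \<Rightarrow> complex) \<Rightarrow> planar_system \<Rightarrow> planar_system"
  where "blowup_uv a b S = (\<lambda>x u v.
    case S x (a x + u) (b x + u * v) of (P, Q) \<Rightarrow>
      (P - deriv a x, (Q - deriv b x - v * (P - deriv a x)) / u))"

definition blowup_UV :: "(complex \<Rightarrow> complex) \<Rightarrow> (complex \<Rightarrow> complex) \<Rightarrow> planar_system \<Rightarrow> planar_system"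
  where "blowup_UV a b S = (\<lambda>x U V.
    case S x (a x + U * V) (b x + V) of (P, Q) \<Rightarrow>
      ((P - deriv a x - U * (Q - deriv b x)) / V, Q - deriv b x))"

text \<open>
  A tree of successive blow-ups for a system that involves an undetermined function \<open>p\<close>; its
  branches are the cascades. The centre is a pair of functions of \<open>x\<close> that depends on \<open>p\<close>. It is
  written in the coordinates of the chart in which the point is blown up: for the subtrees these
  are the chart \<open>(u, v)\<close> (first list) and the chart \<open>(U, V)\<close> (second list) of the preceding blow-up.
  A base point that is visible in both charts need only be blown up in one of them.
\<close>

datatype blowup_tree =
  Blowup (centre: "(complex \<Rightarrow> complex) \<Rightarrow> complex \<Rightarrow> complex \<times> complex")
    (subtrees_uv: "blowup_tree list") (subtrees_UV: "blowup_tree list")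

text \<open>
  All base points on the exceptional curve are among the points \<open>(0, v)\<close>, \<open>v \<in> vs\<close>, of the chart
  \<open>(u, v)\<close> and \<open>(U, 0)\<close>, \<open>U \<in> Us\<close>, of the chart \<open>(U, V)\<close>. On the curve the two charts are related by
  \<open>U v = 1\<close>.
\<close>

definition base_points_within ::
    "planar_system \<Rightarrow> planar_system \<Rightarrow> complex \<Rightarrow> complex set \<Rightarrow> complex set \<Rightarrow> bool"
  where "base_points_within S1 S2 x vs Us \<longleftrightarrow>
    (\<forall>v. (0, v) \<in> base_points S1 x \<longrightarrow> v \<in> vs \<or> (\<exists>U\<in>Us. U * v = 1)) \<and>
    (\<forall>U. (U, 0) \<in> base_points S2 x \<longrightarrow> U \<in> Us \<or> (\<exists>v\<in>vs. U * v = 1))"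

definition regular_on_last_curve :: "complex set \<Rightarrow> planar_system \<Rightarrow> planar_system \<Rightarrow> bool"
  where "regular_on_last_curve W S1 S2 \<longleftrightarrow>
    (\<forall>x\<in>W. \<forall>v. (0, v) \<in> regular_points S1 x) \<or> (\<forall>x\<in>W. \<forall>U. (U, 0) \<in> regular_points S2 x)"

text \<open>
  \<open>S1\<close> and \<open>S2\<close> are the final charts of a cascade. For an undetermined function a final chart
  without indeterminacy is left. The other chart may retain an indeterminacy on the last
  exceptional curve as long as the regularising condition is violated; none remains in either chart
  once the system is regular on that curve.
\<close>

definition cascade_ends :: "complex set \<Rightarrow> planar_system \<Rightarrow> planar_system \<Rightarrow> bool"
  where "cascade_ends W S1 S2 \<longleftrightarrow>
    ((\<forall>x\<in>W. \<forall>v. (0, v) \<notin> base_points S1 x) \<or> (\<forall>x\<in>W. \<forall>U. (U, 0) \<notin> base_points S2 x)) \<and>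
    (regular_on_last_curve W S1 S2 \<longrightarrow> (\<forall>x\<in>W. base_points_within S1 S2 x {} {}))"

text \<open>
  The tree records the blow-ups of the base points of \<open>S\<close>, the system for the function \<open>p\<close>: each
  centre is a base point, and after each blow-up precisely the base points on the new exceptional
  curve are blown up.
\<close>

fun blowup_process :: "complex set \<Rightarrow> (complex \<Rightarrow> complex) \<Rightarrow> planar_system \<Rightarrow> blowup_tree \<Rightarrow> bool"
  where "blowup_process W p S (Blowup c ts Ts) =
   (let a = (\<lambda>x. fst (c p x)); b = (\<lambda>x. snd (c p x));
        S1 = blowup_uv a b S; S2 = blowup_UV a b S
    in a holomorphic_on W \<and> b holomorphic_on W \<and>
       (\<forall>x\<in>W. (a x, b x) \<in> base_points S x) \<and>
       (\<forall>t\<in>set ts. (\<forall>x\<in>W. fst (centre t p x) = 0) \<and> blowup_process W p S1 t) \<and>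
       (\<forall>t\<in>set Ts. (\<forall>x\<in>W. snd (centre t p x) = 0) \<and> blowup_process W p S2 t) \<and>
       (if ts = [] \<and> Ts = [] then cascade_ends W S1 S2
        else (\<forall>x\<in>W. base_points_within S1 S2 x
                ((\<lambda>t. snd (centre t p x)) ` set ts) ((\<lambda>t. fst (centre t p x)) ` set Ts))))"

fun regular_cascades :: "complex set \<Rightarrow> (complex \<Rightarrow> complex) \<Rightarrow> planar_system \<Rightarrow> blowup_tree \<Rightarrow> bool"
  where "regular_cascades W p S (Blowup c ts Ts) =
   (let a = (\<lambda>x. fst (c p x)); b = (\<lambda>x. snd (c p x));
        S1 = blowup_uv a b S; S2 = blowup_UV a b S
    in if ts = [] \<and> Ts = [] then regular_on_last_curve W S1 S2
       else (\<forall>t\<in>set ts. regular_cascades W p S1 t) \<and> (\<forall>t\<in>set Ts. regular_cascades W p S2 t))"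

text \<open>
  In the projective plane the base points of the three charts \<open>(y, z)\<close>, \<open>(u\<^sub>0, v\<^sub>0)\<close>, \<open>(U\<^sub>0, V\<^sub>0)\<close> are
  compared in homogeneous coordinates. The lists \<open>T0\<close>, \<open>T1\<close>, \<open>T2\<close> contain the blow-ups performed in
  these charts.
\<close>

definition same_point :: "complex \<times> complex \<times> complex \<Rightarrow> complex \<times> complex \<times> complex \<Rightarrow> bool"
  where "same_point P Q \<longleftrightarrow> (case (P, Q) of ((p0, p1, p2), (q0, q1, q2)) \<Rightarrow>
    \<exists>c. c \<noteq> 0 \<and> p0 = c * q0 \<and> p1 = c * q1 \<and> p2 = c * q2)"

definition hom_yz :: "complex \<times> complex \<Rightarrow> complex \<times> complex \<times> complex"
  where "hom_yz = (\<lambda>(y, z). (1, y, z))"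

definition hom_u0v0 :: "complex \<times> complex \<Rightarrow> complex \<times> complex \<times> complex"
  where "hom_u0v0 = (\<lambda>(u, v). (u, 1, v))"

definition hom_U0V0 :: "complex \<times> complex \<Rightarrow> complex \<times> complex \<times> complex"
  where "hom_U0V0 = (\<lambda>(U, V). (V, U, 1))"

type_synonym forest = "blowup_tree list \<times> blowup_tree list \<times> blowup_tree list"

definition regularisation_process ::
    "complex set \<Rightarrow> (complex \<Rightarrow> complex) \<Rightarrow> planar_system \<Rightarrow> forest \<Rightarrow> bool"
  where "regularisation_process W p S F \<longleftrightarrow> (case F of (T0, T1, T2) \<Rightarrow>
    (\<forall>t\<in>set T0. blowup_process W p S t) \<and>
    (\<forall>t\<in>set T1. blowup_process W p (chart_u0v0 S) t) \<and>
    (\<forall>t\<in>set T2. blowup_process W p (chart_U0V0 S) t) \<and>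
    (\<forall>x\<in>W. \<forall>P \<in> hom_yz ` base_points S x \<union> hom_u0v0 ` base_points (chart_u0v0 S) x \<union>
                 hom_U0V0 ` base_points (chart_U0V0 S) x.
       \<exists>Q \<in> (\<lambda>t. hom_yz (centre t p x)) ` set T0 \<union> (\<lambda>t. hom_u0v0 (centre t p x)) ` set T1 \<union>
            (\<lambda>t. hom_U0V0 (centre t p x)) ` set T2.
         same_point P Q))"

definition regularised :: "complex set \<Rightarrow> (complex \<Rightarrow> complex) \<Rightarrow> planar_system \<Rightarrow> forest \<Rightarrow> bool"
  where "regularised W p S F \<longleftrightarrow> (case F of (T0, T1, T2) \<Rightarrow>
    (\<forall>t\<in>set T0. regular_cascades W p S t) \<and>
    (\<forall>t\<in>set T1. regular_cascades W p (chart_u0v0 S) t) \<and>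
    (\<forall>t\<in>set T2. regular_cascades W p (chart_U0V0 S) t))"


section \<open>Bureau-Guillot systems\<close>

text \<open>Differential polynomials in one function: \<open>Der n\<close> is its \<open>n\<close>-th derivative, \<open>Indep\<close> is \<open>x\<close>.\<close>

datatype diff_poly =
  Const complex | Indep | Der nat | Plus diff_poly diff_poly | Times diff_poly diff_poly

primrec dp_eval :: "diff_poly \<Rightarrow> (complex \<Rightarrow> complex) \<Rightarrow> complex \<Rightarrow> complex" where
  "dp_eval (Const c) p x = c"
| "dp_eval Indep p x = x"
| "dp_eval (Der n) p x = (deriv ^^ n) p x"
| "dp_eval (Plus E F) p x = dp_eval E p x + dp_eval F p x"
| "dp_eval (Times E F) p x = dp_eval E p x * dp_eval F p x"

definition dr_eval :: "diff_poly \<times> diff_poly \<Rightarrow> (complex \<Rightarrow> complex) \<Rightarrow> complex \<Rightarrow> complex"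
  where "dr_eval r p x = dp_eval (fst r) p x / dp_eval (snd r) p x"

definition undetermined :: "(complex \<times> complex) set \<Rightarrow> complex set \<Rightarrow> (complex \<Rightarrow> complex) \<Rightarrow> bool"
  where "undetermined A W p \<longleftrightarrow>
    open W \<and> connected W \<and> W \<noteq> {} \<and> p holomorphic_on W \<and> (\<forall>x\<in>W. (x, p x) \<in> A)"

definition rational_transformation :: "complex set \<Rightarrow> planar_system \<Rightarrow> bool"
  where "rational_transformation D \<Phi> \<longleftrightarrow>
    (\<exists>N1 M1 N2 M2 :: complex \<Rightarrow> complex poly poly.
       (\<forall>K\<in>{N1, M1, N2, M2}. \<forall>i j. (\<lambda>x. coeff (coeff (K x) j) i) holomorphic_on D) \<and>
       (\<forall>x\<in>D. M1 x \<noteq> 0 \<and> M2 x \<noteq> 0 \<and>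
          (\<forall>y z. eval2 (M1 x) y z \<noteq> 0 \<and> eval2 (M2 x) y z \<noteq> 0 \<longrightarrow>
             \<Phi> x y z = (eval2 (N1 x) y z / eval2 (M1 x) y z, eval2 (N2 x) y z / eval2 (M2 x) y z))))"

definition transforms_into ::
    "complex set \<Rightarrow> planar_system \<Rightarrow> (complex \<Rightarrow> complex poly poly) \<Rightarrow> planar_system \<Rightarrow> planar_system \<Rightarrow> bool"
  where "transforms_into D \<Phi> E S T \<longleftrightarrow>
    (\<forall>W y z. open W \<and> W \<subseteq> D \<and> (\<forall>x\<in>W. eval2 (E x) (y x) (z x) \<noteq> 0) \<and> solves S W y z \<longrightarrow>
       solves T W (\<lambda>x. fst (\<Phi> x (y x) (z x))) (\<lambda>x. snd (\<Phi> x (y x) (z x))))"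

definition birationally_equivalent :: "complex set \<Rightarrow> planar_system \<Rightarrow> planar_system \<Rightarrow> bool"
  where "birationally_equivalent D S T \<longleftrightarrow>
    (\<exists>\<Phi> \<Psi> E F. rational_transformation D \<Phi> \<and> rational_transformation D \<Psi> \<and>
       (\<forall>x\<in>D. E x \<noteq> 0 \<and> F x \<noteq> 0) \<and>
       (\<forall>x\<in>D. \<forall>y z. eval2 (E x) y z \<noteq> 0 \<longrightarrow> (case \<Phi> x y z of (y3, z3) \<Rightarrow> \<Psi> x y3 z3) = (y, z)) \<and>
       (\<forall>x\<in>D. \<forall>y z. eval2 (F x) y z \<noteq> 0 \<longrightarrow> (case \<Psi> x y z of (y1, z1) \<Rightarrow> \<Phi> x y1 z1) = (y, z)) \<and>
       transforms_into D \<Phi> E S T \<and> transforms_into D \<Psi> F T S)"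

text \<open>
  The right-hand side \<open>f\<close> (a family depending on the function \<open>p\<close>) is a rational function of
  \<open>(y, z)\<close> whose coefficients \<open>n i j\<close>, \<open>m i j\<close> are rational in \<open>x\<close>, \<open>p\<close> and the derivatives of \<open>p\<close>;
  for the given function \<open>q\<close> on \<open>D\<close> the coefficients are meromorphic.
\<close>

definition coefficients_from_transcendent ::
    "(complex \<times> complex) set \<Rightarrow> complex set \<Rightarrow> (complex \<Rightarrow> complex) \<Rightarrow>
     ((complex \<Rightarrow> complex) \<Rightarrow> complex \<Rightarrow> complex \<Rightarrow> complex \<Rightarrow> complex) \<Rightarrow> bool"
  where "coefficients_from_transcendent A D q f \<longleftrightarrow>
    (\<exists>(d::nat) (n :: nat \<Rightarrow> nat \<Rightarrow> diff_poly \<times> diff_poly) m.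
       (\<forall>i j. (\<lambda>x. dr_eval (n i j) q x) meromorphic_on D \<and>
              (\<lambda>x. dr_eval (m i j) q x) meromorphic_on D) \<and>
       (\<forall>W p x. undetermined A W p \<and> x \<in> W \<longrightarrow>
          (\<forall>i j. dp_eval (snd (n i j)) p x \<noteq> 0 \<and> dp_eval (snd (m i j)) p x \<noteq> 0) \<and>
          (\<exists>i\<le>d. \<exists>j\<le>d. dr_eval (m i j) p x \<noteq> 0) \<and>
          (\<forall>y z. (\<Sum>i\<le>d. \<Sum>j\<le>d. dr_eval (m i j) p x * y ^ i * z ^ j) \<noteq> 0 \<longrightarrow>
             f p x y z = (\<Sum>i\<le>d. \<Sum>j\<le>d. dr_eval (n i j) p x * y ^ i * z ^ j) /
                         (\<Sum>i\<le>d. \<Sum>j\<le>d. dr_eval (m i j) p x * y ^ i * z ^ j))))"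

text \<open>
  \<open>S p\<close> is the system for an undetermined function \<open>p\<close>. The regularising conditions \<open>Es\<close> are
  differential equations for \<open>p\<close>, not satisfied by every function; they characterise the functions
  for which the system is regular on the last exceptional curves, and they hold for the solutions
  of \<open>y'' = R(x, y, y')\<close>.
\<close>

definition obtained_as_regularising_condition ::
    "(complex \<times> complex) set \<Rightarrow> (complex \<Rightarrow> complex \<Rightarrow> complex \<Rightarrow> complex) \<Rightarrow>
     ((complex \<Rightarrow> complex) \<Rightarrow> planar_system) \<Rightarrow> bool"
  where "obtained_as_regularising_condition A R S \<longleftrightarrow>
    (\<exists>F. \<exists>Es :: diff_poly list.
       (\<forall>W p. undetermined A W p \<longrightarrow>
          regularisation_process W p (S p) F \<and>
          (regularised W p (S p) F \<longleftrightarrow> (\<forall>E\<in>set Es. \<forall>x\<in>W. dp_eval E p x = 0)) \<and>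
          ((\<forall>x\<in>W. deriv (deriv p) x = R x (p x) (deriv p x)) \<longrightarrow>
             (\<forall>E\<in>set Es. \<forall>x\<in>W. dp_eval E p x = 0))) \<and>
       (\<exists>W p. undetermined A W p \<and> \<not> (\<forall>E\<in>set Es. \<forall>x\<in>W. dp_eval E p x = 0)))"

text \<open>
  The system \<open>S q\<close> is Bureau-Guillot for the equation \<open>y'' = R(x, y, y')\<close>, whose associated
  Hamiltonian system is \<open>T\<close> and of which \<open>q\<close> is a solution on \<open>D\<close>.
\<close>

definition bureau_guillot ::
    "(complex \<times> complex) set \<Rightarrow> (complex \<Rightarrow> complex \<Rightarrow> complex \<Rightarrow> complex) \<Rightarrow> planar_system \<Rightarrow>
     ((complex \<Rightarrow> complex) \<Rightarrow> planar_system) \<Rightarrow> complex set \<Rightarrow> (complex \<Rightarrow> complex) \<Rightarrow> bool"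
  where "bureau_guillot A R T S D q \<longleftrightarrow>
    birationally_equivalent (regular_set A D q) (S q) T \<and>
    coefficients_from_transcendent A D q (\<lambda>p x y z. fst (S p x y z)) \<and>
    coefficients_from_transcendent A D q (\<lambda>p x y z. snd (S p x y z)) \<and>
    obtained_as_regularising_condition A R S"


section \<open>The systems for the third Painleve equation of type \<open>D\<^sub>6\<close>\<close>

text \<open>The parameters are written \<open>e0\<close>, \<open>ei\<close>, \<open>k0\<close>, \<open>ki\<close> for \<open>\<eta>\<^sub>0\<close>, \<open>\<eta>\<^sub>\<infinity>\<close>, \<open>\<kappa>\<^sub>0\<close>, \<open>\<kappa>\<^sub>\<infinity>\<close>.\<close>

definition okamoto_hamiltonian ::
    "complex \<Rightarrow> complex \<Rightarrow> complex \<Rightarrow> complex \<Rightarrow> complex \<Rightarrow> complex \<Rightarrow> complex \<Rightarrow> complex"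
  where "okamoto_hamiltonian e0 ei k0 ki x y3 z3 =
    1 / x * (2 * y3\<^sup>2 * z3\<^sup>2 + ei * (k0 + ki) * x * y3
             - z3 * (2 * ei * x * y3\<^sup>2 - 2 * e0 * x + (2 * k0 + 1) * y3))"

definition bg_system :: "complex \<Rightarrow> complex \<Rightarrow> complex \<Rightarrow> (complex \<Rightarrow> complex) \<Rightarrow> planar_system"
  where "bg_system e0 ei k0 f = (\<lambda>x y z. let q = f x; q1 = deriv f x in
    ((3 * (y * z / q\<^sup>2) + 4 * (y / q) + (1 + 2 * k0) / (2 * q ^ 3)) * (2 * e0 - q1)
       + x * (ei\<^sup>2 - e0\<^sup>2 / q ^ 4)
       + x * q1 / (4 * q ^ 4) * (4 * e0 - q1)
       - (3 * (y * z / (x * q)) + 2 * (y / x)) * (1 + 2 * k0)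
       - (1 + 2 * k0)\<^sup>2 / (4 * x * q\<^sup>2)
       - 4 * y\<^sup>2 / x * (3 * z * q + q\<^sup>2 + 2 * z\<^sup>2),
     z / x * ((z / q + 1) * (1 + 2 * k0) + 4 * y * (z + q)\<^sup>2)
       - (z\<^sup>2 / q\<^sup>2 + 2 * z / q) * (2 * e0 - q1)))"

end

theory Submission
  imports Defs "HOL-Computational_Algebra.Polynomial_Factorial"
    "HOL-Computational_Algebra.Field_as_Ring"
begin

text \<open>
  Put \<open>\<kappa> = 2 \<kappa>\<^sub>0 + 1\<close>, \<open>e = x \<eta>\<^sub>\<infinity>\<close> and \<open>m = (x (2 \<eta>\<^sub>0 - p') - \<kappa> p) / p\<^sup>2\<close>. Then \<open>z\<^sub>3 = y z + e/2 - m/4\<close>, and for an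
  arbitrary function \<open>p\<close> in place of \<open>q\<close> the system is \<open>x y' = E + 3 m y z + (4 m p + 2 \<kappa>) y - 4 y\<^sup>2 (p + z) (p + 2 z)\<close>,
  \<open>x z' = - m z\<^sup>2 - (2 m p + \<kappa>) z + 4 y z (z + p)\<^sup>2\<close> with \<open>E = e\<^sup>2 - m\<^sup>2/4\<close>. Its base points in the plane are
  \<open>[0:1:0]\<close> and \<open>[0:0:1]\<close>. The first leads to a cascade at \<open>z = 0\<close>, regular after one blow-up, and
  to one at \<open>z = - p\<close> (a zero of \<open>y\<^sub>3\<close>), where the resonance condition holds identically in \<open>p\<close>. The second
  leads to the two points \<open>y z = m/4 \<plusminus> e/2\<close> (poles of \<open>y\<^sub>3\<close>); the next base point over each of them has the
  coordinate \<open>\<Omega> = (g \<plusminus> \<kappa>\<^sub>0 \<eta>\<^sub>\<infinity>) / (\<plusminus> 2 \<eta>\<^sub>\<infinity>)\<close> for a function \<open>g\<close> of \<open>x, p, p', p''\<close>, and the final chart is regular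
  if and only if \<open>\<Omega>' = 0\<close>. Hence the regularising condition is \<open>g' = 0\<close>, and the third Painleve equation for
  \<open>p\<close> says precisely that \<open>g = \<alpha>/4\<close>.
\<close>

section \<open>Local behaviour of rational functions of two variables\<close>

definition poly2 :: "(complex \<Rightarrow> complex \<Rightarrow> complex) \<Rightarrow> bool"
  where "poly2 f \<longleftrightarrow> (\<exists>N. \<forall>y z. f y z = eval2 N y z)"

lemma eval2_simps [simp]:
  "eval2 (A + B) y z = eval2 A y z + eval2 B y z"
  "eval2 (A - B) y z = eval2 A y z - eval2 B y z"
  "eval2 (- A) y z = - eval2 A y z"
  "eval2 (A * B) y z = eval2 A y z * eval2 B y z"
  "eval2 (A ^ n) y z = eval2 A y z ^ n"
  "eval2 0 y z = 0"
  "eval2 1 y z = 1"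
  "eval2 [:[:c:]:] y z = c"
  "eval2 [:[:0, 1:]:] y z = y"
  "eval2 [:0, 1:] y z = z"
  by (simp_all add: eval2_def poly_power)

lemma poly2_intros:
  "poly2 f \<Longrightarrow> poly2 g \<Longrightarrow> poly2 (\<lambda>y z. f y z + g y z)"
  "poly2 f \<Longrightarrow> poly2 g \<Longrightarrow> poly2 (\<lambda>y z. f y z - g y z)"
  "poly2 f \<Longrightarrow> poly2 g \<Longrightarrow> poly2 (\<lambda>y z. f y z * g y z)"
  "poly2 f \<Longrightarrow> poly2 (\<lambda>y z. - f y z)"
  "poly2 f \<Longrightarrow> poly2 (\<lambda>y z. f y z ^ n)"
  "poly2 (\<lambda>y z. y)"
  "poly2 (\<lambda>y z. z)"
  "poly2 (\<lambda>y z. c)"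
  unfolding poly2_def
  by (metis eval2_simps(1), metis eval2_simps(2), metis eval2_simps(4), metis eval2_simps(3),
      metis eval2_simps(5), metis eval2_simps(9), metis eval2_simps(10), metis eval2_simps(8))

text \<open>For each fixed z the polynomial in y has every complex number as a root, hence is zero.
  A nonzero N would then have infinitely many constant roots \<open>[:z:]\<close>.\<close>

lemma eval2_eq_0_imp:
  assumes "\<And>y z. eval2 N y z = 0"
  shows "N = 0"
proof (rule ccontr)
  assume "N \<noteq> 0"
  then have "finite {r. poly N r = 0}" by (rule poly_roots_finite)
  moreover have "range (\<lambda>z. [:z:]) \<subseteq> {r. poly N r = 0}"
    using assms unfolding eval2_def
    by (metis (mono_tags, lifting) image_subsetI mem_Collect_eq poly_all_0_iff_0)
  moreover have "infinite (range (\<lambda>z::complex. [:z:]))"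
    by (simp add: finite_image_iff inj_def infinite_UNIV_char_0)
  ultimately show False using finite_subset by blast
qed

text \<open>The curve E plays the same part as in \<open>lowest_terms\<close>: it absorbs the points
  where a chart formula divides by zero.\<close>

definition generic :: "(complex \<Rightarrow> complex \<Rightarrow> bool) \<Rightarrow> bool"
  where "generic P \<longleftrightarrow> (\<exists>E. E \<noteq> 0 \<and> (\<forall>y z. eval2 E y z \<noteq> 0 \<longrightarrow> P y z))"

lemma generic_nonzero:
  assumes "poly2 f" and "f a b \<noteq> 0"
  shows "generic (\<lambda>y z. f y z \<noteq> 0)"
  using assms unfolding poly2_def generic_def by (metis eval2_simps(6))

lemma generic_conj: "generic P \<Longrightarrow> generic Q \<Longrightarrow> generic (\<lambda>y z. P y z \<and> Q y z)"
  unfolding generic_def by (metis eval2_simps(4) mult_eq_0_iff)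

lemma generic_mono: "generic P \<Longrightarrow> (\<And>y z. P y z \<Longrightarrow> Q y z) \<Longrightarrow> generic Q"
  unfolding generic_def by blast

lemma generic_fst: "generic (\<lambda>y z. y \<noteq> 0)"
  by (rule generic_nonzero[where f = "\<lambda>y z. y" and a = 1 and b = 1]) (rule poly2_intros, simp)

lemma generic_snd: "generic (\<lambda>y z. z \<noteq> 0)"
  by (rule generic_nonzero[where f = "\<lambda>y z. z" and a = 1 and b = 1]) (rule poly2_intros, simp)

section \<open>Unreduced fractions compared with lowest terms\<close>

definition quotient_of :: "(complex \<Rightarrow> complex \<Rightarrow> complex) \<Rightarrow> (complex \<Rightarrow> complex \<Rightarrow> complex) \<Rightarrow>
    (complex \<Rightarrow> complex \<Rightarrow> complex) \<Rightarrow> bool"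
  where "quotient_of f n d \<longleftrightarrow> poly2 n \<and> poly2 d \<and> generic (\<lambda>y z. d y z \<noteq> 0 \<and> f y z = n y z / d y z)"

lemma quotient_ofI:
  assumes "poly2 n" "poly2 d" "generic P" "\<And>y z. P y z \<Longrightarrow> d y z \<noteq> 0"
    "\<And>y z. P y z \<Longrightarrow> f y z = n y z / d y z"
  shows "quotient_of f n d"
  unfolding quotient_of_def
  by (intro conjI assms(1,2) generic_mono[OF assms(3)]) (simp_all add: assms(4,5))

text \<open>Two fractions for f agree off a curve. Cross-multiplying and cancelling in the integral
  domain of polynomials turns this into an identity of polynomials, so a fraction found by computing
  in a chart can be compared with the reduced one.\<close>

lemma quotient_of_lowest_terms:
  assumes "quotient_of f n d"
  shows "\<exists>N M. (\<forall>y z. eval2 N y z = n y z) \<and> (\<forall>y z. eval2 M y z = d y z) \<and> M \<noteq> 0 \<and>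
    (\<forall>N' M'. lowest_terms f N' M' \<longrightarrow> N * M' = N' * M)"
proof -
  obtain N M where N: "\<And>y z. n y z = eval2 N y z" and M: "\<And>y z. d y z = eval2 M y z"
    using assms unfolding quotient_of_def poly2_def by blast
  obtain E where E: "E \<noteq> 0"
    "\<And>y z. eval2 E y z \<noteq> 0 \<Longrightarrow> eval2 M y z \<noteq> 0 \<and> f y z = eval2 N y z / eval2 M y z"
    using assms unfolding quotient_of_def generic_def N M by blast
  have "M \<noteq> 0"
  proof
    assume "M = 0"
    then have "eval2 E y z = 0" for y z using E(2)[of y z] by auto
    then show False using E(1) eval2_eq_0_imp by blast
  qed
  moreover have "N * M' = N' * M" if low: "lowest_terms f N' M'" for N' M'
  proof -
    from low obtain E' where E': "M' \<noteq> 0" "E' \<noteq> 0"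
      "\<And>y z. eval2 E' y z \<noteq> 0 \<Longrightarrow> f y z = eval2 N' y z / eval2 M' y z"
      unfolding lowest_terms_def by blast
    \<comment> \<open>The extra factors make the product vanish on the exceptional curves as well,
      hence everywhere.\<close>
    have "eval2 (E * E' * M' * (N * M' - N' * M)) y z = 0" for y z
    proof (cases "eval2 E y z = 0 \<or> eval2 E' y z = 0 \<or> eval2 M' y z = 0")
      case False
      then have "eval2 N y z / eval2 M y z = eval2 N' y z / eval2 M' y z" "eval2 M y z \<noteq> 0"
        using E(2)[of y z] E'(3)[of y z] by simp_all
      with False have "eval2 N y z * eval2 M' y z = eval2 N' y z * eval2 M y z"
        by (simp add: frac_eq_eq)
      then show ?thesis by simp
    qed auto
    then have "E * E' * M' * (N * M' - N' * M) = 0" by (rule eval2_eq_0_imp)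
    then show ?thesis using E(1) E'(1,2) by simp
  qed
  ultimately show ?thesis using N M by metis
qed

text \<open>By coprimality the reduced numerator and denominator divide the given ones, so a common
  zero of the reduced pair is also a common zero of n and d.\<close>

lemma not_indeterminate_at:
  assumes "quotient_of f n d" and "n y z \<noteq> 0 \<or> d y z \<noteq> 0"
  shows "\<not> indeterminate_at f y z"
proof
  assume "indeterminate_at f y z"
  then obtain N' M' where low: "lowest_terms f N' M'"
    and 0: "eval2 N' y z = 0" "eval2 M' y z = 0"
    unfolding indeterminate_at_def by blast
  obtain N M where NM: "\<forall>y z. eval2 N y z = n y z" "\<forall>y z. eval2 M y z = d y z"
    and "\<forall>N' M'. lowest_terms f N' M' \<longrightarrow> N * M' = N' * M"
    using quotient_of_lowest_terms[OF assms(1)] by (elim exE conjE) (rule that, assumption+)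
  then have eq: "N * M' = N' * M" using low by simp
  have cop: "coprime N' M'" and "M' \<noteq> 0" using low unfolding lowest_terms_def by auto
  have "N' dvd N * M'" "M' dvd N' * M"
    using eq by (metis dvd_triv_left) (metis eq dvd_triv_right)
  then have "N' dvd N" "M' dvd M"
    using coprime_dvd_mult_left_iff[OF cop] coprime_dvd_mult_right_iff[OF cop[unfolded coprime_commute[of N']]]
    by blast+
  then obtain A B where "N = N' * A" "M = M' * B" by (elim dvdE)
  then have "eval2 N y z = 0" "eval2 M y z = 0" using 0 by simp_all
  then show False using assms(2) NM by simp
qed

text \<open>Evaluating \<open>N * M' = N' * M\<close> at the point forces every reduced denominator
  M' to vanish there.\<close>

lemma not_regular_at:
  assumes "quotient_of f n d" and "n y z \<noteq> 0" and "d y z = 0"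
  shows "\<not> regular_at f y z"
proof
  assume "regular_at f y z"
  then obtain N' M' where low: "lowest_terms f N' M'" and 0: "eval2 M' y z \<noteq> 0"
    unfolding regular_at_def by blast
  obtain N M where NM: "\<forall>y z. eval2 N y z = n y z" "\<forall>y z. eval2 M y z = d y z"
    and "\<forall>N' M'. lowest_terms f N' M' \<longrightarrow> N * M' = N' * M"
    using quotient_of_lowest_terms[OF assms(1)] by (elim exE conjE) (rule that, assumption+)
  then have eq: "N * M' = N' * M" using low by simp
  have "eval2 (N * M') y z = eval2 (N' * M) y z" using eq by simp
  then show False using assms 0 NM by simp
qed

text \<open>The gcd is divided out. Its factor C is kept in the statement because nonvanishing of d
  at a point then passes to M'.\<close>

lemma lowest_terms_exists:
  assumes "quotient_of f n d"
  shows "\<exists>N' M' C. lowest_terms f N' M' \<and> (\<forall>y z. d y z = eval2 C y z * eval2 M' y z)"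
proof -
  obtain N M where N: "\<forall>y z. eval2 N y z = n y z" and M: "\<forall>y z. eval2 M y z = d y z"
    and "M \<noteq> 0"
    using quotient_of_lowest_terms[OF assms] by (elim exE conjE) (rule that, assumption+)
  define C where "C = gcd N M"
  have "C \<noteq> 0" using \<open>M \<noteq> 0\<close> C_def by simp
  then obtain N' M' where NM': "N = N' * C" "M = M' * C" "coprime N' M'"
    using gcd_coprime_exists[of N M] unfolding C_def by blast
  obtain E where E: "E \<noteq> 0"
    "\<forall>y z. eval2 E y z \<noteq> 0 \<longrightarrow> d y z \<noteq> 0 \<and> f y z = n y z / d y z"
    using assms unfolding quotient_of_def generic_def by blast
  have d: "d y z = eval2 C y z * eval2 M' y z" and n: "n y z = eval2 C y z * eval2 N' y z" for y z
    using N[rule_format, of y z] M[rule_format, of y z] unfolding NM'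
    by (simp_all add: mult.commute)
  have "lowest_terms f N' M'"
    unfolding lowest_terms_def
  proof (intro conjI exI[of _ E] allI impI)
    show "M' \<noteq> 0" using NM'(2) \<open>M \<noteq> 0\<close> by auto
    fix y z assume "eval2 E y z \<noteq> 0"
    then have "d y z \<noteq> 0" "f y z = n y z / d y z" using E(2) by simp_all
    then show "f y z = eval2 N' y z / eval2 M' y z" unfolding d n by simp
  qed (fact NM'(3), fact E(1))
  then show ?thesis using d by blast
qed

lemma regular_atI:
  assumes "quotient_of f n d" and "d y z \<noteq> 0"
  shows "regular_at f y z"
proof -
  obtain N M C where "lowest_terms f N M" "\<forall>y z. d y z = eval2 C y z * eval2 M y z"
    using lowest_terms_exists[OF assms(1)] by (elim exE conjE) (rule that, assumption+)
  then have "lowest_terms f N M" "eval2 M y z \<noteq> 0" using assms(2) by simp_all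
  then show ?thesis unfolding regular_at_def by (intro exI conjI)
qed

text \<open>A common factor of \<open>n\<close> and \<open>t ^ k * d\<close> divides \<open>d\<close>, because the prime \<open>t\<close> does not divide
  \<open>n\<close>; since \<open>d\<close> does not vanish at the point, cancellation does not remove the indeterminacy.\<close>

lemma indeterminate_at_prime:
  assumes q: "quotient_of f n (\<lambda>y z. eval2 t y z ^ k * d y z)"
    and t: "prime_elem t" "k > 0" "eval2 t a b = 0" and dvd: "\<And>s. t dvd s \<Longrightarrow> eval2 s ya za = 0"
    and n: "n ya za \<noteq> 0" "n a b = 0" and d: "poly2 d" "d a b \<noteq> 0"
  shows "indeterminate_at f a b"
proof -
  obtain N' M' where low: "lowest_terms f N' M'"
    using lowest_terms_exists[OF q] by (elim exE conjE) (rule that)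
  obtain N M where NM: "\<forall>y z. eval2 N y z = n y z"
    "\<forall>y z. eval2 M y z = eval2 t y z ^ k * d y z"
    and "\<forall>N' M'. lowest_terms f N' M' \<longrightarrow> N * M' = N' * M"
    using quotient_of_lowest_terms[OF q] by (elim exE conjE) (rule that, assumption+)
  then have eq: "N * M' = N' * M" using low by simp
  obtain G where G: "\<forall>y z. d y z = eval2 G y z" using d(1) unfolding poly2_def by blast
  have "M = t ^ k * G"
  proof -
    have "M - t ^ k * G = 0" by (rule eval2_eq_0_imp) (simp add: NM G)
    then show ?thesis by simp
  qed
  then have eq': "N * M' = t ^ k * (N' * G)" using eq by (simp add: mult_ac)
  have "\<not> t dvd N" using dvd n NM by metis
  then have "t ^ k dvd M'" using prime_power_dvd_multD[OF t(1) _ t(2)] eq' by (metis dvd_triv_left)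
  then obtain M'' where M'': "M' = t ^ k * M''" by (elim dvdE)
  have "t \<noteq> 0" using t(1) by auto
  then have "N * M'' = N' * G" using eq' M'' by (simp add: mult.left_commute)
  then have "eval2 (N * M'') a b = eval2 (N' * G) a b" by simp
  then have "eval2 N' a b = 0" using n d by (simp add: NM G)
  moreover have "eval2 M' a b = 0" using t M'' by simp
  ultimately show ?thesis using low unfolding indeterminate_at_def by blast
qed

lemma prime_elem_fst: "prime_elem ([:[:0, 1:]:] :: complex poly poly)"
  by (simp add: prime_elem_const_poly_iff prime_elem_linear_field_poly)

lemma prime_elem_snd: "prime_elem ([:0, 1:] :: complex poly poly)"
  by (rule prime_elem_linear_poly) auto

text \<open>The prime is the equation y = 0 of an exceptional curve. The point v1 of that curve,
  where n does not vanish, certifies that y does not divide n.\<close>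

lemma indeterminate_at_fst:
  assumes "quotient_of f n (\<lambda>y z. y ^ k * d y z)" "k > 0" "n 0 v1 \<noteq> 0" "n 0 v = 0"
    "poly2 d" "d 0 v \<noteq> 0"
  shows "indeterminate_at f 0 v"
proof -
  have "eval2 s 0 v1 = 0" if "[:[:0, 1:]:] dvd s" for s
    using that by (elim dvdE) (simp add: eval2_def)
  then show ?thesis
    using indeterminate_at_prime[where t = "[:[:0, 1:]:]" and ya = 0 and za = v1 and a = 0 and b = v
        and f = f and n = n and d = d and k = k, unfolded eval2_simps, OF assms(1) prime_elem_fst assms(2)]
      assms(3-6) by simp
qed

lemma indeterminate_at_snd:
  assumes "quotient_of f n (\<lambda>y z. z ^ k * d y z)" "k > 0" "n u1 0 \<noteq> 0" "n u 0 = 0"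
    "poly2 d" "d u 0 \<noteq> 0"
  shows "indeterminate_at f u 0"
proof -
  have "eval2 s u1 0 = 0" if "[:0, 1:] dvd s" for s
    using that by (elim dvdE) (simp add: eval2_def)
  then show ?thesis
    using indeterminate_at_prime[where t = "[:0, 1:]" and ya = u1 and za = 0 and a = u and b = 0
        and f = f and n = n and d = d and k = k, unfolded eval2_simps, OF assms(1) prime_elem_snd assms(2)]
      assms(3-6) by simp
qed

section \<open>The charts of the regularisation at a fixed value of \<open>x\<close>\<close>

text \<open>
  Moving centres enter only through their values \<open>a\<close>, \<open>b\<close> and the values \<open>a'\<close>, \<open>b'\<close> of their
  derivatives at the given \<open>x\<close>.
\<close>

type_synonym vfield = "complex \<Rightarrow> complex \<Rightarrow> complex \<times> complex"

definition proj_u :: "vfield \<Rightarrow> vfield"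
  where "proj_u F u v = (case F (1 / u) (v / u) of (P, Q) \<Rightarrow> (- (u\<^sup>2) * P, u * (Q - v * P)))"

definition proj_U :: "vfield \<Rightarrow> vfield"
  where "proj_U F U V = (case F (U / V) (1 / V) of (P, Q) \<Rightarrow> (V * (P - U * Q), - (V\<^sup>2) * Q))"

definition blow_uv :: "complex \<Rightarrow> complex \<Rightarrow> complex \<Rightarrow> complex \<Rightarrow> vfield \<Rightarrow> vfield"
  where "blow_uv a b a' b' F u v =
    (case F (a + u) (b + u * v) of (P, Q) \<Rightarrow> (P - a', (Q - b' - v * (P - a')) / u))"

definition blow_UV :: "complex \<Rightarrow> complex \<Rightarrow> complex \<Rightarrow> complex \<Rightarrow> vfield \<Rightarrow> vfield"
  where "blow_UV a b a' b' F U V =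
    (case F (a + U * V) (b + V) of (P, Q) \<Rightarrow> ((P - a' - U * (Q - b')) / V, Q - b'))"

text \<open>With every division written as a product with inverses, \<open>algebra\<close> can treat
  inverses as variables tied by \<open>right_inverse\<close>, and an identity of rational
  expressions becomes a question of ideal membership.\<close>

lemmas field_inverse = divide_inverse inverse_mult_distrib power_inverse[symmetric]

definition base_at :: "vfield \<Rightarrow> complex \<Rightarrow> complex \<Rightarrow> bool"
  where "base_at F a b \<longleftrightarrow>
    indeterminate_at (\<lambda>y z. fst (F y z)) a b \<or> indeterminate_at (\<lambda>y z. snd (F y z)) a b"

definition reg_at :: "vfield \<Rightarrow> complex \<Rightarrow> complex \<Rightarrow> bool"
  where "reg_at F a b \<longleftrightarrow>
    regular_at (\<lambda>y z. fst (F y z)) a b \<and> regular_at (\<lambda>y z. snd (F y z)) a b"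

definition chart_form where
  "chart_form F n d n' d' \<longleftrightarrow>
    quotient_of (\<lambda>y z. fst (F y z)) n d \<and> quotient_of (\<lambda>y z. snd (F y z)) n' d'"

text \<open>Generic conditions are closed under conjunction, so a formula may be checked away from
  several curves. The conditions in use are the two coordinates and one further denominator.\<close>

lemma chart_form3:
  assumes "generic P" "generic Q" "generic R"
    and "\<And>y z. P y z \<Longrightarrow> Q y z \<Longrightarrow> R y z \<Longrightarrow> F y z = (n y z / d y z, n' y z / d' y z)"
    and "poly2 n" "poly2 d" "poly2 n'" "poly2 d'"
    and "\<And>y z. P y z \<Longrightarrow> Q y z \<Longrightarrow> R y z \<Longrightarrow> d y z \<noteq> 0"
    and "\<And>y z. P y z \<Longrightarrow> Q y z \<Longrightarrow> R y z \<Longrightarrow> d' y z \<noteq> 0"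
  shows "chart_form F n d n' d'"
proof -
  have g: "generic (\<lambda>y z. P y z \<and> Q y z \<and> R y z)" by (intro generic_conj assms(1-3))
  show ?thesis
    unfolding chart_form_def
    by (intro conjI quotient_ofI[OF assms(5,6) g] quotient_ofI[OF assms(7,8) g])
       (simp_all add: assms(4,9,10))
qed

lemma chart_form2:
  assumes "generic P" "generic Q"
    and "\<And>y z. P y z \<Longrightarrow> Q y z \<Longrightarrow> F y z = (n y z / d y z, n' y z / d' y z)"
    and "poly2 n" "poly2 d" "poly2 n'" "poly2 d'"
    and "\<And>y z. P y z \<Longrightarrow> Q y z \<Longrightarrow> d y z \<noteq> 0" "\<And>y z. P y z \<Longrightarrow> Q y z \<Longrightarrow> d' y z \<noteq> 0"
  shows "chart_form F n d n' d'"
  using chart_form3[OF assms(1,2,2), of F n d n' d'] assms(3-) by blast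

lemma chart_form1:
  assumes "generic P"
    and "\<And>y z. P y z \<Longrightarrow> F y z = (n y z / d y z, n' y z / d' y z)"
    and "poly2 n" "poly2 d" "poly2 n'" "poly2 d'"
    and "\<And>y z. P y z \<Longrightarrow> d y z \<noteq> 0" "\<And>y z. P y z \<Longrightarrow> d' y z \<noteq> 0"
  shows "chart_form F n d n' d'"
  using chart_form2[OF assms(1,1), of F n d n' d'] assms(2-) by blast

lemma not_base_at:
  assumes "chart_form F n d n' d'" "n a b \<noteq> 0 \<or> d a b \<noteq> 0" "n' a b \<noteq> 0 \<or> d' a b \<noteq> 0"
  shows "\<not> base_at F a b"
  using assms not_indeterminate_at unfolding base_at_def chart_form_def by blast

lemma reg_atI:
  assumes "chart_form F n d n' d'" "d a b \<noteq> 0" "d' a b \<noteq> 0"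
  shows "reg_at F a b"
  using assms regular_atI unfolding reg_at_def chart_form_def by blast

lemma not_reg_at:
  assumes "chart_form F n d n' d'" "n a b \<noteq> 0 \<and> d a b = 0 \<or> n' a b \<noteq> 0 \<and> d' a b = 0"
  shows "\<not> reg_at F a b"
  using assms not_regular_at unfolding reg_at_def chart_form_def by blast

text \<open>In these names the first \<open>fst\<close> or \<open>snd\<close> is the component of
  the vector field that is indeterminate, the second is the coordinate that vanishes on the
  curve.\<close>

lemma base_at_fst_fst:
  assumes "chart_form F n d n' d'" "d = (\<lambda>y z. y ^ k * c y z)" "k > 0" "n 0 t \<noteq> 0" "n 0 b = 0"
    "poly2 c" "c 0 b \<noteq> 0"
  shows "base_at F 0 b"
  using indeterminate_at_fst[of "\<lambda>y z. fst (F y z)" n k c t b] assms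
  unfolding base_at_def chart_form_def by simp

lemma base_at_snd_fst:
  assumes "chart_form F n d n' d'" "d' = (\<lambda>y z. y ^ k * c y z)" "k > 0" "n' 0 t \<noteq> 0" "n' 0 b = 0"
    "poly2 c" "c 0 b \<noteq> 0"
  shows "base_at F 0 b"
  using indeterminate_at_fst[of "\<lambda>y z. snd (F y z)" n' k c t b] assms
  unfolding base_at_def chart_form_def by simp

lemma base_at_fst_snd:
  assumes "chart_form F n d n' d'" "d = (\<lambda>y z. z ^ k * c y z)" "k > 0" "n t 0 \<noteq> 0" "n a 0 = 0"
    "poly2 c" "c a 0 \<noteq> 0"
  shows "base_at F a 0"
  using indeterminate_at_snd[of "\<lambda>y z. fst (F y z)" n k c t a] assms
  unfolding base_at_def chart_form_def by simp

section \<open>The vector field at one value of x, with q = p(x), m, E and K = 2 k0 + 1 as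
  parameters\<close>

context
  fixes x q m E K :: complex
  assumes x: "x \<noteq> 0" and q: "q \<noteq> 0"
begin

definition fA :: vfield where "fA y z =
  ((E + 3 * m * y * z + (4 * m * q + 2 * K) * y - 4 * y^2 * (q + z) * (q + 2 * z)) / x,
   (- m * z^2 - (2 * m * q + K) * z + 4 * y * z * (z + q)^2) / x)"

text \<open>
  Coordinates: \<open>(1/y, z/y)\<close> in \<open>fB0\<close>, \<open>(1/y, z)\<close> in \<open>fB1\<close>, \<open>(y/z, 1/z)\<close> in \<open>fG0\<close>, \<open>(y, 1/z)\<close> in \<open>fG1\<close>,
  \<open>(y z, 1/z)\<close> in \<open>fG2\<close>. A prime in a lemma name marks the other chart of the same blow-up.
\<close>

abbreviation "fB0 \<equiv> proj_u fA"
abbreviation "fB1 \<equiv> blow_uv 0 0 0 0 fB0"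
abbreviation "fG0 \<equiv> proj_U fA"
abbreviation "fG1 \<equiv> blow_UV 0 0 0 0 fG0"
abbreviation "fG2 \<equiv> blow_UV 0 0 0 0 fG1"

text \<open>This and the later chart formulas display numerators whose values on the exceptional
  curve can be read off: their zeros there are the candidates for base points.\<close>

lemma fB0_eq: assumes "u \<noteq> 0"
  shows "fB0 u v =
  ((- (u^4) * E - 3 * m * v * u^2 - (4 * m * q + 2 * K) * u^3 + 4 * (q * u + v) * (q * u + 2 * v)) / (u^2 * x),
   (- (u^4) * v * E - 4 * m * v^2 * u^2 - (6 * m * q + 3 * K) * v * u^3 + 4 * v * (v + q * u) * (2 * q * u + 3 * v)) / (u^3 * x))"
  unfolding proj_u_def fA_def prod.case prod.inject field_inverse
  using right_inverse[OF assms] by (intro conjI; algebra)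

lemma fB1_eq: assumes "u \<noteq> 0"
  shows "fB1 u z =
  ((- (u^2) * E - 3 * m * u * z - (4 * m * q + 2 * K) * u + 4 * (q + z) * (q + 2 * z)) / x,
   (- m * z^2 * u - (2 * m * q + K) * z * u + 4 * z * (z + q)^2) / (u * x))"
  unfolding blow_uv_def add_0 fB0_eq[OF assms] prod.case prod.inject field_inverse
  using right_inverse[OF assms] by (intro conjI; algebra)

lemma fB1'_eq: assumes "U \<noteq> 0" "V \<noteq> 0"
  shows "blow_UV 0 0 0 0 fB0 U V =
  ((m * U^2 * V + (2 * m * q + K) * U^3 * V - 4 * (1 + q * U)^2) / (U^2 * V * x),
   (- (U^4) * V^2 * E - 4 * m * V * U^2 - (6 * m * q + 3 * K) * V * U^3 + 4 * (1 + q * U) * (2 * q * U + 3)) / (U^3 * x))"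
proof -
  have "U * V \<noteq> 0" using assms by simp
  then show ?thesis
    unfolding blow_UV_def add_0 fB0_eq[OF \<open>U * V \<noteq> 0\<close>] prod.case prod.inject field_inverse
    using right_inverse[OF assms(1)] right_inverse[OF assms(2)] by (intro conjI; algebra)
qed

text \<open>Putting z = u w cancels the pole 1/u of z', and the terms 4 q^2 w of z' and of w u'
  cancel on u = 0. Both components are therefore polynomial, and this cascade ends without a
  condition.\<close>

lemma fB1_blow_uv_eq: assumes "u \<noteq> 0"
  shows "blow_uv 0 0 0 0 fB1 u w =
  ((- (u^2) * E - 3 * m * u^2 * w - (4 * m * q + 2 * K) * u + 4 * (q + u * w) * (q + 2 * u * w)) / x,
   (u * w * E + 2 * m * u * w^2 + (2 * m * q + K) * w - 4 * w^2 * (q + u * w)) / x)"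
  unfolding blow_uv_def[of _ _ _ _ fB1] add_0 fB1_eq[OF assms] prod.case prod.inject field_inverse
  apply (intro conjI)
  subgoal by algebra
  subgoal using right_inverse[OF assms] by algebra
  done

lemma fB1_blow_UV_eq: assumes "U \<noteq> 0" "V \<noteq> 0"
  shows "blow_UV 0 0 0 0 fB1 U V =
  ((- (U^2) * V * E - 2 * m * U * V - (2 * m * q + K) * U + 4 * (q + V)) / x,
   (- m * V^2 * U - (2 * m * q + K) * V * U + 4 * (V + q)^2) / (U * x))"
proof -
  have "U * V \<noteq> 0" using assms by simp
  then show ?thesis
    unfolding blow_UV_def add_0 fB1_eq[OF \<open>U * V \<noteq> 0\<close>] prod.case prod.inject field_inverse
    using right_inverse[OF assms(1)] right_inverse[OF assms(2)] by (intro conjI; algebra)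
qed

lemma not_base_A: "\<not> base_at fA y z"
  by (rule not_base_at[OF chart_form1[OF generic_fst fA_def]])
     (use x in \<open>auto intro!: poly2_intros\<close>)

lemma base_B0: "base_at fB0 0 0"
  by (rule base_at_fst_fst[OF chart_form1[OF generic_fst fB0_eq], where k = 2 and c = "\<lambda>_ _. x" and t = 1])
     (use x in \<open>auto intro!: poly2_intros\<close>)

lemma not_base_B0: "\<not> base_at fB0 u v" if "u \<noteq> 0 \<or> v \<noteq> 0"
  by (rule not_base_at[OF chart_form1[OF generic_fst fB0_eq]])
     (use x that in \<open>auto intro!: poly2_intros\<close>)

text \<open>On u = 0 the numerator of z' is 4 z (z + q)^2; it does not vanish at the witness z =
  q.\<close>

lemma base_B1: "base_at fB1 0 z" if "z = 0 \<or> z = - q"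
  by (rule base_at_snd_fst[OF chart_form1[OF generic_fst fB1_eq], where k = 1 and c = "\<lambda>_ _. x" and t = q])
     (use x q that in \<open>auto intro!: poly2_intros\<close>)

lemma not_base_B1: "\<not> base_at fB1 0 z" if "z \<noteq> 0" "z \<noteq> - q"
  by (rule not_base_at[OF chart_form1[OF generic_fst fB1_eq]])
     (use x that in \<open>auto intro!: poly2_intros simp: eq_neg_iff_add_eq_0\<close>)

text \<open>On V = 0 the first numerator is - 4 (1 + q U)^2. Its zero U = - 1/q is the point z = - q
  again.\<close>

lemma not_base_B1': "\<not> base_at (blow_UV 0 0 0 0 fB0) U 0" if "1 + q * U \<noteq> 0"
  by (rule not_base_at[OF chart_form2[OF generic_fst generic_snd fB1'_eq]])
     (use x that in \<open>auto intro!: poly2_intros\<close>)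

lemma reg_Z: "reg_at (blow_uv 0 0 0 0 fB1) 0 w"
  by (rule reg_atI[OF chart_form1[OF generic_fst fB1_blow_uv_eq]]) (use x in \<open>auto intro!: poly2_intros\<close>)

lemma not_base_Z: "\<not> base_at (blow_uv 0 0 0 0 fB1) 0 w"
  by (rule not_base_at[OF chart_form1[OF generic_fst fB1_blow_uv_eq]]) (use x in \<open>auto intro!: poly2_intros\<close>)

lemma not_base_Z': "\<not> base_at (blow_UV 0 0 0 0 fB1) U 0"
  by (rule not_base_at[OF chart_form2[OF generic_fst generic_snd fB1_blow_UV_eq]])
     (use x q in \<open>auto intro!: poly2_intros\<close>)

subsection \<open>The cascade of the point \<open>z = - p\<close> over \<open>[0:1:0]\<close>\<close>

text \<open>
  Here \<open>X = 2 \<eta>\<^sub>0 x\<close>. With \<open>t = z + q\<close> the coordinates are \<open>(1/(y t), t)\<close> in \<open>fC1\<close> and \<open>(1/(y t\<^sup>2), t)\<close> in \<open>fD1\<close>.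
\<close>

context
  fixes q' X :: complex
  assumes X: "X \<noteq> 0" and rel: "m * q^2 = X - x * q' - K * q"
begin

abbreviation "fC1 \<equiv> blow_UV 0 (- q) 0 (- q') fB1"
abbreviation "fD1 \<equiv> blow_UV 0 0 0 0 fC1"

text \<open>The double zero of (z + q)^2 removes the pole in V from the second component. The motion
  of the centre contributes m q^2 + K q + x q', which \<open>rel\<close> collapses to X, so the
  derivative of p disappears.\<close>

lemma fC1_eq: assumes "U \<noteq> 0" "V \<noteq> 0"
  shows "fC1 U V =
  ((- (U^2) * V^2 * E - 2 * m * U * V^2 - (m * q + K) * U * V + 4 * V^2 - X * U) / (V * x),
   (4 * (V - q) * V + (- m * V^2 - K * V + X) * U) / (U * x))"
proof -
  have "U * V \<noteq> 0" using assms by simp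
  then show ?thesis
    unfolding blow_UV_def add_0 fB1_eq[OF \<open>U * V \<noteq> 0\<close>] prod.case prod.inject field_inverse
    using right_inverse[OF assms(1)] right_inverse[OF assms(2)] right_inverse[OF x] rel
    by (intro conjI; algebra)
qed

lemma fC1'_eq: assumes "u \<noteq> 0"
  shows "blow_uv 0 (- q) 0 (- q') fB1 u v =
  ((- (u^2) * E - 3 * m * u^2 * v - (m * q + 2 * K) * u + 4 * u * v * (2 * u * v - q)) / x,
   (- 4 * u^2 * v^3 + u^2 * v * E + 2 * m * u^2 * v^2 + (m * q + K) * u * v + X) / (u * x))"
  unfolding blow_uv_def[of _ _ _ _ fB1] add_0 fB1_eq[OF assms] prod.case prod.inject field_inverse
  apply (intro conjI)
  subgoal by algebra
  subgoal using right_inverse[OF assms] right_inverse[OF x] rel by algebra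
  done

lemma fD1_eq: assumes "A \<noteq> 0" "V \<noteq> 0"
  shows "fD1 A V =
  ((4 * q - 2 * X * A - m * q * A * V - m * A * V^2 - E * A^2 * V^3) / (V * x),
   (4 * (V - q) + (- m * V^2 - K * V + X) * A) / (A * x))"
proof -
  have AV: "A * V \<noteq> 0" using assms by simp
  show ?thesis
    unfolding blow_UV_def[of _ _ _ _ fC1] add_0 fC1_eq[OF AV assms(2)] prod.case prod.inject field_inverse
    using right_inverse[OF assms(1)] right_inverse[OF assms(2)]
    by (intro conjI; algebra)
qed

lemma fD1'_eq: assumes "u \<noteq> 0" "v \<noteq> 0"
  shows "blow_uv 0 0 0 0 fC1 u v =
  ((- (u^3) * v^2 * E - 2 * m * u^2 * v^2 - (m * q + K) * u * v + 4 * u * v^2 - X) / (v * x),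
   (- 4 * q * v + 2 * X + u^3 * v^2 * E + m * u^2 * v^2 + m * q * u * v) / (u * x))"
proof -
  have uv: "u * v \<noteq> 0" using assms by simp
  show ?thesis
    unfolding blow_uv_def[of _ _ _ _ fC1] add_0 fC1_eq[OF assms(1) uv] prod.case prod.inject field_inverse
    using right_inverse[OF assms(1)] right_inverse[OF assms(2)]
    by (intro conjI; algebra)
qed

lemma base_C1: "base_at fC1 0 0"
  by (rule base_at_fst_snd[OF chart_form2[OF generic_fst generic_snd fC1_eq], where k = 1 and c = "\<lambda>_ _. x" and t = 1])
     (use x X in \<open>auto intro!: poly2_intros\<close>)

lemma not_base_C1: "\<not> base_at fC1 U 0" if "U \<noteq> 0"
  by (rule not_base_at[OF chart_form2[OF generic_fst generic_snd fC1_eq]])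
     (use x X that in \<open>auto intro!: poly2_intros\<close>)

lemma not_base_C1': "\<not> base_at (blow_uv 0 (- q) 0 (- q') fB1) 0 v"
  by (rule not_base_at[OF chart_form1[OF generic_fst fC1'_eq]])
     (use x X in \<open>auto intro!: poly2_intros\<close>)

text \<open>On V = 0 the numerators are 4 q - 2 X A and X A - 4 q. The first has the single zero A =
  2 q / X; the second covers A = 0, where its denominator vanishes.\<close>

lemma not_base_D1: "\<not> base_at fD1 A 0" if "2 * q \<noteq> X * A"
  by (rule not_base_at[OF chart_form2[OF generic_fst generic_snd fD1_eq]])
     (use x q that in \<open>auto intro!: poly2_intros\<close>)

lemma not_base_D1': "\<not> base_at (blow_uv 0 0 0 0 fC1) 0 v" if "X \<noteq> 2 * q * v"
  by (rule not_base_at[OF chart_form2[OF generic_fst generic_snd fD1'_eq]])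
     (use x X that in \<open>auto intro!: poly2_intros\<close>)

text \<open>
  \<open>A0\<close> and \<open>a\<close> are the last two base points, \<open>A0'\<close> and \<open>a'\<close> their derivatives. The assumption on \<open>a'\<close> is
  the resonance condition; it will turn out to hold for every \<open>p\<close>.
\<close>

context
  fixes A0 A0' a a' r :: complex
  assumes A0: "X * A0 = 2 * q" and a: "m * q * A0 + x * A0' + X * a = 0"
   and r: "2 + X * a = 2 * r * A0" and a': "K * a - m * q * a - m * A0 - 4 * r * a = x * a'"
begin

abbreviation "fE1 \<equiv> blow_UV A0 0 A0' 0 fD1"
abbreviation "fF1 \<equiv> blow_UV a 0 a' 0 fE1"

lemma fE1_eq: assumes "V \<noteq> 0" "A \<noteq> 0" "A0 + \<alpha> * V = A"
  shows "fE1 \<alpha> V =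
  ((A * (- X * \<alpha> - m * q * A - m * A * V - E * A^2 * V^2 - x * A0' + \<alpha> * V * (m * V + K)) - \<alpha> * V * (4 + 2 * X * \<alpha>)) / (V * A * x),
   (4 * (V - q) + (- m * V^2 - K * V + X) * A) / (A * x))"
  unfolding blow_UV_def[of _ _ _ _ fD1] add_0 assms(3) fD1_eq[OF assms(2,1)] prod.case prod.inject field_inverse
  apply (intro conjI)
  subgoal using right_inverse[OF assms(1)] right_inverse[OF assms(2)] right_inverse[OF x] A0 assms(3) by algebra
  subgoal by algebra
  done

lemma fE1'_eq: assumes "u \<noteq> 0" "v \<noteq> 0" "A \<noteq> 0" "A0 + u = A"
  shows "blow_uv A0 0 A0' 0 fD1 u v =
  ((- 2 * X - m * q * A * v - m * A * u * v^2 - E * A^2 * u^2 * v^3 - x * A0' * v) / (v * x),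
   (A * (X + v * (m * q * A + m * A * u * v + E * A^2 * u^2 * v^2 + x * A0'))
      + u * (4 * v + 2 * X - (m * u * v^2 + K * v) * A)) / (u * A * x))"
proof -
  have uv: "u * v \<noteq> 0" using assms by simp
  show ?thesis
    unfolding blow_uv_def[of _ _ _ _ fD1] add_0 assms(4) fD1_eq[OF assms(3) uv] prod.case prod.inject field_inverse
    apply (intro conjI)
    subgoal using right_inverse[OF assms(1)] right_inverse[OF assms(2)] right_inverse[OF x] A0 assms(4) by algebra
    subgoal using right_inverse[OF assms(1)] right_inverse[OF assms(2)] right_inverse[OF assms(3)] right_inverse[OF x] A0 assms(4) by algebra
    done
qed

text \<open>Regularity comes from two cancellations on V = 0. The terms in \<beta> cancel because V'
  equals - X/x there, by X A0 = 2 q. The remaining constant is removed by \<open>a'\<close>, where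
  \<open>r\<close> writes 4 + 2 X a as 4 r A0 so that A0 divides out.\<close>

lemma fF1_eq: assumes "V \<noteq> 0" "A \<noteq> 0" "a + \<beta> * V = \<alpha>" "A0 + \<alpha> * V = A"
  shows "fF1 \<beta> V =
  ((A * (- m * q * \<beta> + 2 * K * \<beta> - E * A^2 + m * \<beta> * V)
      - (4 * \<beta> + 2 * X * \<beta> * (a + \<alpha>) - 4 * r * a * \<alpha>) - \<beta> * (4 + 2 * X * \<alpha>)) / (A * x),
   (4 * (V - q) + (- m * V^2 - K * V + X) * A) / (A * x))"
  unfolding blow_UV_def[of _ _ _ _ fE1] add_0 assms(3) fE1_eq[OF assms(1,2,4)] prod.case prod.inject field_inverse
  apply (intro conjI)
  subgoal using right_inverse[OF assms(1)] right_inverse[OF assms(2)] right_inverse[OF x] A0 a r a' assms(3,4) by algebra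
  subgoal by algebra
  done

lemma fF1'_eq: assumes "u \<noteq> 0" "v \<noteq> 0" "A \<noteq> 0" "a + u = \<alpha>" "A0 + \<alpha> * (u * v) = A"
  shows "blow_uv a 0 a' 0 fE1 u v =
  ((- X * A + u * v * (A * (- m * q + K - E * A^2 * v) - (4 + 2 * X * (a + \<alpha>) - 4 * r * a * \<alpha> * v))) / (v * A * x),
   v * (4 + 2 * X * \<alpha> - A * (m * u * v + K) - A * (- m * q + K - E * A^2 * v)
      + 4 + 2 * X * (a + \<alpha>) - 4 * r * a * \<alpha> * v) / (A * x))"
proof -
  have uv: "u * v \<noteq> 0" using assms by simp
  show ?thesis
    unfolding blow_uv_def[of _ _ _ _ fE1] add_0 assms(4) fE1_eq[OF uv assms(3,5)] prod.case prod.inject field_inverse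
    apply (intro conjI)
    subgoal using right_inverse[OF assms(1)] right_inverse[OF assms(2)] right_inverse[OF assms(3)] right_inverse[OF x] A0 a r a' assms(4,5) by algebra
    subgoal using right_inverse[OF assms(1)] right_inverse[OF assms(2)] right_inverse[OF assms(3)] right_inverse[OF x] A0 a r a' assms(4,5) by algebra
    done
qed

lemma A0_nonzero: "A0 \<noteq> 0"
  using A0 q by auto

lemma generic_A1: "generic (\<lambda>\<alpha> V. A0 + \<alpha> * V \<noteq> 0)"
  and generic_A2: "generic (\<lambda>u v. A0 + u \<noteq> 0)"
  and generic_A3: "generic (\<lambda>\<beta> V. A0 + (a + \<beta> * V) * V \<noteq> 0)"
  and generic_A4: "generic (\<lambda>u v. A0 + (a + u) * (u * v) \<noteq> 0)"
  by (rule generic_nonzero[where a = 0 and b = 0], intro poly2_intros, simp add: A0_nonzero)+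

lemma base_D1: "base_at fD1 A0 0"
  by (rule base_at_fst_snd[OF chart_form2[OF generic_fst generic_snd fD1_eq], where k = 1 and c = "\<lambda>_ _. x" and t = 0])
     (use x q A0 in \<open>auto intro!: poly2_intros simp: mult.commute\<close>)

lemma base_E1: "base_at fE1 a 0"
proof (rule base_at_fst_snd[OF chart_form2[OF generic_snd generic_A1 fE1_eq[OF _ _ refl]],
      where k = 1 and c = "\<lambda>\<alpha> V. (A0 + \<alpha> * V) * x" and t = "a + 1"])
  have *: "- (X * t) - m * q * A0 - x * A0' = - X * (t - a)" for t
    using a by algebra
  show "(A0 + (a + 1) * 0) * (- X * (a + 1) - m * q * (A0 + (a + 1) * 0) - m * (A0 + (a + 1) * 0) * 0 -
      E * (A0 + (a + 1) * 0)\<^sup>2 * 0\<^sup>2 - x * A0' + (a + 1) * 0 * (m * 0 + K)) -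
      (a + 1) * 0 * (4 + 2 * X * (a + 1)) \<noteq> 0"
    using *[of "a + 1"] A0_nonzero X by simp
  show "(A0 + a * 0) * (- X * a - m * q * (A0 + a * 0) - m * (A0 + a * 0) * 0 -
      E * (A0 + a * 0)\<^sup>2 * 0\<^sup>2 - x * A0' + a * 0 * (m * 0 + K)) - a * 0 * (4 + 2 * X * a) = 0"
    using *[of a] by simp
qed (use x A0_nonzero in \<open>auto intro!: poly2_intros simp: mult_ac\<close>)

lemma not_base_E1: "\<not> base_at fE1 \<alpha> 0" if "\<alpha> \<noteq> a"
proof -
  have "- (X * \<alpha>) - m * q * A0 - x * A0' = - X * (\<alpha> - a)"
    using a by algebra
  then show ?thesis
    by (intro not_base_at[OF chart_form2[OF generic_snd generic_A1 fE1_eq[OF _ _ refl]]])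
       (use that x X A0_nonzero in \<open>auto intro!: poly2_intros\<close>)
qed

text \<open>The condition is a product because \<open>a\<close> may vanish at some x; the base point
  is then invisible in this chart.\<close>

lemma not_base_E1': "\<not> base_at (blow_uv A0 0 A0' 0 fD1) 0 v" if "a * v \<noteq> 1"
proof -
  have "X + v * (m * q * A0 + x * A0') = X * (1 - a * v)"
    using a by algebra
  moreover have "1 - a * v \<noteq> 0" using that by simp
  ultimately show ?thesis
    by (intro not_base_at[OF chart_form3[OF generic_fst generic_snd generic_A2 fE1'_eq[OF _ _ _ refl]]])
       (use x X A0_nonzero in \<open>auto intro!: poly2_intros\<close>)
qed

lemma reg_F1: "reg_at fF1 \<beta> 0"
  by (rule reg_atI[OF chart_form2[OF generic_snd generic_A3 fF1_eq[OF _ _ refl refl]]])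
     (use x A0_nonzero in \<open>auto intro!: poly2_intros\<close>)

lemma not_base_F1: "\<not> base_at fF1 \<beta> 0"
  by (rule not_base_at[OF chart_form2[OF generic_snd generic_A3 fF1_eq[OF _ _ refl refl]]])
     (use x A0_nonzero in \<open>auto intro!: poly2_intros\<close>)

lemma not_base_F1': "\<not> base_at (blow_uv a 0 a' 0 fE1) 0 v"
  by (rule not_base_at[OF chart_form3[OF generic_fst generic_snd generic_A4 fF1'_eq[OF _ _ _ refl refl]]])
     (use x X A0_nonzero in \<open>auto intro!: poly2_intros\<close>)

end

end

subsection \<open>The cascades over \<open>[0:0:1]\<close>\<close>

lemma fG0_eq: assumes "V \<noteq> 0"
  shows "fG0 U V =
  ((V^4 * E + 4 * m * U * V^2 + (6 * m * q + 3 * K) * U * V^3 - 4 * U^2 * (1 + q * V) * (3 + 2 * q * V)) / (V^3 * x),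
   (m * V^2 + (2 * m * q + K) * V^3 - 4 * U * (1 + q * V)^2) / (V^2 * x))"
  unfolding proj_U_def fA_def prod.case prod.inject field_inverse
  using right_inverse[OF assms] by (intro conjI; algebra)

lemma fG1_eq: assumes "V \<noteq> 0"
  shows "fG1 U V =
  ((V^2 * E + 3 * m * U * V + (4 * m * q + 2 * K) * U * V^2 - 4 * U^2 * (1 + q * V) * (2 + q * V)) / (V^2 * x),
   (m * V + (2 * m * q + K) * V^2 - 4 * U * (1 + q * V)^2) / (V * x))"
  unfolding blow_UV_def add_0 fG0_eq[OF assms] prod.case prod.inject field_inverse
  using right_inverse[OF assms] by (intro conjI; algebra)

lemma fG1'_eq: assumes "u \<noteq> 0" "v \<noteq> 0"
  shows "blow_uv 0 0 0 0 fG0 u v =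
  ((u^2 * v^4 * E + 4 * m * u * v^2 + (6 * m * q + 3 * K) * u^2 * v^3 - 4 * (1 + q * u * v) * (3 + 2 * q * u * v)) / (u * v^3 * x),
   (- (u^2) * v^4 * E - 3 * m * u * v^2 - (4 * m * q + 2 * K) * u^2 * v^3 + 4 * (1 + q * u * v) * (2 + q * u * v)) / (u^2 * v^2 * x))"
proof -
  have uv: "u * v \<noteq> 0" using assms by simp
  show ?thesis
    unfolding blow_uv_def add_0 fG0_eq[OF uv] prod.case prod.inject field_inverse
    using right_inverse[OF assms(1)] right_inverse[OF assms(2)]
    by (intro conjI; algebra)
qed

text \<open>In the coordinate w = y z the pole is simple, and on V = 0 its numerator is a quadratic
  in w. For E = e^2 - m^2/4 it equals e^2 - (2 w - m/2)^2, so it has the two simple roots m/4 + e/2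
  and m/4 - e/2.\<close>

lemma fG2_eq: assumes "V \<noteq> 0"
  shows "fG2 w V =
  ((E + 2 * m * w - 4 * w^2 + V * ((2 * m * q + K) * w - 4 * q * w^2)) / (V * x),
   (m + (2 * m * q + K) * V - 4 * w * (1 + q * V)^2) / x)"
  unfolding blow_UV_def[of _ _ _ _ fG1] add_0 fG1_eq[OF assms] prod.case prod.inject field_inverse
  using right_inverse[OF assms] by (intro conjI; algebra)

lemma fG2'_eq: assumes "u \<noteq> 0" "v \<noteq> 0"
  shows "blow_uv 0 0 0 0 fG1 u v =
  ((v^2 * E + 3 * m * v + (4 * m * q + 2 * K) * u * v^2 - 4 * (1 + q * u * v) * (2 + q * u * v)) / (v^2 * x),
   (- (v^2) * E - 2 * m * v - (2 * m * q + K) * u * v^2 + 4 * (1 + q * u * v)) / (u * v * x))"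
proof -
  have uv: "u * v \<noteq> 0" using assms by simp
  show ?thesis
    unfolding blow_uv_def[of _ _ _ _ fG1] add_0 fG1_eq[OF uv] prod.case prod.inject field_inverse
    using right_inverse[OF assms(1)] right_inverse[OF assms(2)]
    by (intro conjI; algebra)
qed

lemma base_G0: "base_at fG0 0 0"
  by (rule base_at_fst_snd[OF chart_form1[OF generic_snd fG0_eq], where k = 3 and c = "\<lambda>_ _. x" and t = 1])
     (use x in \<open>auto intro!: poly2_intros\<close>)

lemma not_base_G0: "\<not> base_at fG0 U V" if "U \<noteq> 0 \<or> V \<noteq> 0"
  by (rule not_base_at[OF chart_form1[OF generic_snd fG0_eq]])
     (use x that in \<open>auto intro!: poly2_intros\<close>)

lemma base_G1: "base_at fG1 0 0"
  by (rule base_at_fst_snd[OF chart_form1[OF generic_snd fG1_eq], where k = 2 and c = "\<lambda>_ _. x" and t = 1])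
     (use x in \<open>auto intro!: poly2_intros\<close>)

lemma not_base_G1: "\<not> base_at fG1 U 0" if "U \<noteq> 0"
  by (rule not_base_at[OF chart_form1[OF generic_snd fG1_eq]])
     (use x that in \<open>auto intro!: poly2_intros\<close>)

lemma not_base_G1': "\<not> base_at (blow_uv 0 0 0 0 fG0) 0 v"
  by (rule not_base_at[OF chart_form2[OF generic_fst generic_snd fG1'_eq]])
     (auto intro!: poly2_intros simp: x)

lemma not_base_G2: "\<not> base_at fG2 w 0" if "E + 2 * m * w - 4 * w^2 \<noteq> 0"
  by (rule not_base_at[OF chart_form1[OF generic_snd fG2_eq]])
     (use x that in \<open>auto intro!: poly2_intros\<close>)

lemma not_base_G2': "\<not> base_at (blow_uv 0 0 0 0 fG1) 0 v" if "v^2 * E + 2 * m * v \<noteq> 4"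
proof -
  have "- v\<^sup>2 * E - 2 * m * v + 4 \<noteq> 0" using that by (simp add: algebra_simps eq_neg_iff_add_eq_0)
  then show ?thesis
    by (intro not_base_at[OF chart_form2[OF generic_fst generic_snd fG2'_eq]])
       (use x in \<open>auto intro!: poly2_intros\<close>)
qed

text \<open>Both base points on the curve are covered: \<open>h = \<plusminus> e\<close>.\<close>

context
  fixes h w0 w0' \<Omega>0 \<Omega>0' :: complex
  assumes h: "h \<noteq> 0" and w0: "4 * w0 = m + 2 * h" and E: "E = h^2 - m^2 / 4"
    and \<Omega>0: "(2 * m * q + K) * w0 - 4 * q * w0^2 - x * w0' = 2 * h * \<Omega>0"
begin

abbreviation "fG3 \<equiv> blow_UV w0 0 w0' 0 fG2"
abbreviation "fG4 \<equiv> blow_UV \<Omega>0 0 \<Omega>0' 0 fG3"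

lemma m_h: "m = 4 * w0 - 2 * h"
  using w0 by simp

text \<open>Together with \<open>m_h\<close> this eliminates m and E without fractions, which leaves
  polynomial identities for \<open>algebra\<close>.\<close>

lemma E_h: "E = h^2 - (2 * w0 - h)^2"
proof -
  have "m / 2 = 2 * w0 - h" unfolding m_h by simp
  then have "m^2 / 4 = (2 * w0 - h)^2" by (simp add: power_divide flip: \<open>m / 2 = 2 * w0 - h\<close>)
  then show ?thesis using E by simp
qed

text \<open>On V = 0 the linear part of the quadratic at w0 gives - 4 h \<Omega>, and subtracting
  \<Omega> V' adds 2 h \<Omega>. The constant is 2 h \<Omega>0 by hypothesis, so \<Omega>0 is the
  only zero.\<close>

lemma fG3_eq: assumes V: "V \<noteq> 0" and w: "w0 + \<Omega> * V = w"
  shows "fG3 \<Omega> V =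
  ((2 * h * (\<Omega>0 - \<Omega>) + 4 * q * \<Omega> * V^2 * (\<Omega> + q * w)) / (V * x),
   (m + (2 * m * q + K) * V - 4 * w * (1 + q * V)^2) / x)"
proof -
  have w0': "w0' = ((2 * m * q + K) * w0 - 4 * q * w0^2 - 2 * h * \<Omega>0) * inverse x"
    using \<Omega>0 x by (simp add: field_simps)
  show ?thesis
    unfolding blow_UV_def[of _ _ _ _ fG2] add_0 w fG2_eq[OF V] prod.case prod.inject field_inverse
    apply (intro conjI)
    subgoal
      unfolding w0' m_h E_h w[symmetric] using right_inverse[OF V] by algebra
    subgoal by algebra
    done
qed

lemma fG3'_eq: assumes "u \<noteq> 0" "v \<noteq> 0" and w: "w0 + u = w"
  shows "blow_uv w0 0 w0' 0 fG2 u v =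
  ((- 4 * h - 4 * u + v * ((2 * m * q + K) * w - 4 * q * w^2 - x * w0')) / (v * x),
   (2 * h + (2 * m * q + K) * u * v - 8 * q * w * u * v - 4 * q^2 * w * u^2 * v^2
     - v * ((2 * m * q + K) * w - 4 * q * w^2 - x * w0')) / (u * x))"
proof -
  have uv: "u * v \<noteq> 0" using assms by simp
  \<comment> \<open>This puts w0' over the common denominator x. Folding \<open>x * w0'\<close> into
    y first leaves just the two bare occurrences to rewrite.\<close>
  have w0': "w0' = x * w0' * inverse x" using x by simp
  define y where "y = x * w0'"
  show ?thesis
    unfolding blow_uv_def[of _ _ _ _ fG2] add_0 w fG2_eq[OF uv] prod.case prod.inject field_inverse y_def[symmetric]
    apply (subst (1 2) w0') unfolding y_def[symmetric] m_h E_h w[symmetric]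
    apply (intro conjI)
    using right_inverse[OF assms(1)] right_inverse[OF assms(2)]
    by algebra+
qed

text \<open>The terms in \<Psi> cancel on V = 0 because V' equals - 2 h / x there. The only
  obstruction left is the residue - \<Omega>0', which no choice of \<Psi> can remove.\<close>

lemma fG4_eq: assumes "V \<noteq> 0" "\<Omega>0 + \<Psi> * V = \<Omega>" "w0 + \<Omega> * V = w"
  shows "fG4 \<Psi> V =
  ((- x * \<Omega>0' + V * (4 * q * \<Omega> * (\<Omega> + q * w) - \<Psi> * (- 4 * \<Omega> + 2 * m * q + K - 8 * q * w - 4 * q^2 * w * V))) / (V * x),
   (m + (2 * m * q + K) * V - 4 * w * (1 + q * V)^2) / x)"
  unfolding blow_UV_def[of _ _ _ _ fG3] add_0 assms(2) fG3_eq[OF assms(1,3)] prod.case prod.inject field_inverse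
  apply (intro conjI)
  subgoal unfolding m_h assms(2,3)[symmetric] using right_inverse[OF assms(1)] right_inverse[OF x] by algebra
  subgoal by algebra
  done

lemma fG4'_eq: assumes "u \<noteq> 0" "v \<noteq> 0" "\<Omega>0 + u = \<Omega>" "w0 + \<Omega> * (u * v) = w"
  shows "blow_uv \<Omega>0 0 \<Omega>0' 0 fG3 u v =
  ((- 2 * h + v * (4 * q * \<Omega> * u * v * (\<Omega> + q * w) - x * \<Omega>0')) / (v * x),
   v * (u * (- 4 * \<Omega> + 2 * m * q + K - 8 * q * w - 4 * q^2 * w * (u * v) - 4 * q * \<Omega> * v * (\<Omega> + q * w)) + x * \<Omega>0') / (u * x))"
proof -
  have uv: "u * v \<noteq> 0" using assms by simp
  show ?thesis
    unfolding blow_uv_def[of _ _ _ _ fG3] add_0 assms(3) fG3_eq[OF uv assms(4)] prod.case prod.inject field_inverse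
    apply (intro conjI)
    unfolding m_h assms(3,4)[symmetric]
    using right_inverse[OF assms(1)] right_inverse[OF assms(2)] right_inverse[OF x]
    by algebra+
qed

lemma base_G2: "base_at fG2 w0 0"
proof (rule base_at_fst_snd[OF chart_form1[OF generic_snd fG2_eq], where k = 1 and c = "\<lambda>_ _. x" and t = "w0 - h/2"])
  show "E + 2 * m * (w0 - h/2) - 4 * (w0 - h/2)\<^sup>2 + 0 * ((2 * m * q + K) * (w0 - h/2) - 4 * q * (w0 - h/2)\<^sup>2) \<noteq> 0"
    using h unfolding E_h m_h by (simp add: power2_eq_square algebra_simps)
  show "E + 2 * m * w0 - 4 * w0\<^sup>2 + 0 * ((2 * m * q + K) * w0 - 4 * q * w0\<^sup>2) = 0"
    unfolding E_h m_h by (simp add: power2_eq_square algebra_simps)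
qed (use x in \<open>auto intro!: poly2_intros\<close>)

lemma base_G3: "base_at fG3 \<Omega>0 0"
  by (rule base_at_fst_snd[OF chart_form1[OF generic_snd fG3_eq[OF _ refl]], where k = 1 and c = "\<lambda>_ _. x" and t = "\<Omega>0 + 1"])
     (use x h in \<open>auto intro!: poly2_intros\<close>)

lemma not_base_G3: "\<not> base_at fG3 \<Omega> 0" if "\<Omega> \<noteq> \<Omega>0"
  by (rule not_base_at[OF chart_form1[OF generic_snd fG3_eq[OF _ refl]]])
     (use x h that in \<open>auto intro!: poly2_intros\<close>)

lemma not_base_G3': "\<not> base_at (blow_uv w0 0 w0' 0 fG2) 0 v" if "\<Omega>0 * v \<noteq> 1"
proof -
  have "2 * h - v * ((2 * m * q + K) * w0 - 4 * q * w0\<^sup>2 - x * w0') = 2 * h * (1 - \<Omega>0 * v)"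
    unfolding \<Omega>0 by (simp add: algebra_simps)
  moreover have "1 - \<Omega>0 * v \<noteq> 0" using that by simp
  ultimately show ?thesis
    by (intro not_base_at[OF chart_form2[OF generic_fst generic_snd fG3'_eq[OF _ _ refl]]])
       (use x h in \<open>auto intro!: poly2_intros\<close>)
qed

lemma chart_form_G4:
  assumes "\<Omega>0' = 0"
  shows "chart_form fG4
    (\<lambda>\<Psi> V. 4 * q * (\<Omega>0 + \<Psi> * V) * ((\<Omega>0 + \<Psi> * V) + q * (w0 + (\<Omega>0 + \<Psi> * V) * V))
      - \<Psi> * (- 4 * (\<Omega>0 + \<Psi> * V) + 2 * m * q + K - 8 * q * (w0 + (\<Omega>0 + \<Psi> * V) * V)
          - 4 * q^2 * (w0 + (\<Omega>0 + \<Psi> * V) * V) * V)) (\<lambda>_ _. x)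
    (\<lambda>\<Psi> V. m + (2 * m * q + K) * V - 4 * (w0 + (\<Omega>0 + \<Psi> * V) * V) * (1 + q * V)^2) (\<lambda>_ _. x)"
proof (rule chart_form1[OF generic_snd])
  show "fG4 \<Psi> V =
    ((4 * q * (\<Omega>0 + \<Psi> * V) * ((\<Omega>0 + \<Psi> * V) + q * (w0 + (\<Omega>0 + \<Psi> * V) * V))
      - \<Psi> * (- 4 * (\<Omega>0 + \<Psi> * V) + 2 * m * q + K - 8 * q * (w0 + (\<Omega>0 + \<Psi> * V) * V)
          - 4 * q^2 * (w0 + (\<Omega>0 + \<Psi> * V) * V) * V)) / x,
     (m + (2 * m * q + K) * V - 4 * (w0 + (\<Omega>0 + \<Psi> * V) * V) * (1 + q * V)^2) / x)" if "V \<noteq> 0" for \<Psi> V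
    unfolding fG4_eq[OF that refl refl] using assms that by simp
qed (use x in \<open>auto intro!: poly2_intros\<close>)

lemma reg_G4: "reg_at fG4 \<Psi> 0" if "\<Omega>0' = 0"
  by (rule reg_atI[OF chart_form_G4[OF that]]) (use x in auto)

lemma not_reg_G4: "\<not> reg_at fG4 \<Psi> 0" if "\<Omega>0' \<noteq> 0"
  by (rule not_reg_at[OF chart_form1[OF generic_snd fG4_eq[OF _ refl refl]]])
     (use x that in \<open>auto intro!: poly2_intros\<close>)

lemma not_base_G4: "\<not> base_at fG4 \<Psi> 0"
proof (cases "\<Omega>0' = 0")
  case True
  then show ?thesis by (intro not_base_at[OF chart_form_G4]) (use x in auto)
next
  case False
  then show ?thesis
    by (intro not_base_at[OF chart_form1[OF generic_snd fG4_eq[OF _ refl refl]]])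
       (use x in \<open>auto intro!: poly2_intros\<close>)
qed

text \<open>One bad point on the curve excludes this chart: at v = 1 the second numerator is x
  \<Omega>0' over a vanishing denominator.\<close>

lemma not_reg_G4': "\<not> reg_at (blow_uv \<Omega>0 0 \<Omega>0' 0 fG3) 0 1" if "\<Omega>0' \<noteq> 0"
  by (rule not_reg_at[OF chart_form2[OF generic_fst generic_snd fG4'_eq[OF _ _ refl refl]]])
     (use x that in \<open>auto intro!: poly2_intros\<close>)

text \<open>If \<Omega>0' is nonzero, the second component is 0/0 at the origin of this chart. That
  is the indeterminacy which \<open>cascade_ends\<close> tolerates while the regularising condition
  fails.\<close>

lemma not_base_G4': "\<not> base_at (blow_uv \<Omega>0 0 \<Omega>0' 0 fG3) 0 v" if "\<Omega>0' = 0"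
proof (rule not_base_at[OF chart_form2[OF generic_fst generic_snd]])
  show "blow_uv \<Omega>0 0 \<Omega>0' 0 fG3 u v =
    ((- 2 * h + v * (4 * q * (\<Omega>0 + u) * u * v * ((\<Omega>0 + u) + q * (w0 + (\<Omega>0 + u) * (u * v))))) / (v * x),
     v * (- 4 * (\<Omega>0 + u) + 2 * m * q + K - 8 * q * (w0 + (\<Omega>0 + u) * (u * v)) - 4 * q^2 * (w0 + (\<Omega>0 + u) * (u * v)) * (u * v)
      - 4 * q * (\<Omega>0 + u) * v * ((\<Omega>0 + u) + q * (w0 + (\<Omega>0 + u) * (u * v)))) / x)"
    if "u \<noteq> 0" "v \<noteq> 0" for u v
    unfolding fG4'_eq[OF that refl refl] using \<open>\<Omega>0' = 0\<close> that by simp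
qed (use x h in \<open>auto intro!: poly2_intros\<close>)

end

end

section \<open>The cascades\<close>

lemma in_base_points: "(a, b) \<in> base_points S x \<longleftrightarrow> base_at (S x) a b"
  by (simp add: base_points_def base_at_def)

lemma in_regular_points: "(a, b) \<in> regular_points S x \<longleftrightarrow> reg_at (S x) a b"
  by (simp add: regular_points_def reg_at_def)

lemma system_at:
  "chart_u0v0 S x = proj_u (S x)"
  "chart_U0V0 S x = proj_U (S x)"
  "blowup_uv f g S x = blow_uv (f x) (g x) (deriv f x) (deriv g x) (S x)"
  "blowup_UV f g S x = blow_UV (f x) (g x) (deriv f x) (deriv g x) (S x)"
  by (simp_all add: fun_eq_iff chart_u0v0_def proj_u_def chart_U0V0_def proj_U_def
      blowup_uv_def blow_uv_def blowup_UV_def blow_UV_def)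

definition bg_m where
  "bg_m e0 k0 p x = (x * (2 * e0 - deriv p x) - (2 * k0 + 1) * p x) / (p x)^2"

lemma bg_system_at:
  assumes "x \<noteq> 0" "p x \<noteq> 0"
  shows "bg_system e0 ei k0 p x =
    fA x (p x) (bg_m e0 k0 p x) ((x * ei)^2 - (bg_m e0 k0 p x)^2 / 4) (2 * k0 + 1)"
proof (intro ext)
  fix y z
  show "bg_system e0 ei k0 p x y z =
    fA x (p x) (bg_m e0 k0 p x) ((x * ei)^2 - (bg_m e0 k0 p x)^2 / 4) (2 * k0 + 1) y z"
    unfolding bg_system_def fA_def[OF assms] bg_m_def Let_def prod.inject field_inverse
    using right_inverse[OF assms(1)] right_inverse[OF assms(2)]
    by (intro conjI; algebra)
qed

text \<open>The solution of X A0 = 2 q with X = 2 e0 x.\<close>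

definition A_centre where "A_centre e0 p x = p x / (e0 * x)"

text \<open>The solution of 2 + X a = 2 (1 + k0) A0 with X = 2 e0 x.\<close>

definition a_centre where "a_centre e0 k0 p x = ((1 + k0) * p x - e0 * x) / (e0 * x)^2"

text \<open>The sign s = 1 or s = -1 selects one of the two roots of the quadratic in
  \<open>fG2_eq\<close>.\<close>

definition w_centre where "w_centre e0 ei k0 s p x = bg_m e0 k0 p x / 4 + s * (x * ei) / 2"

text \<open>For a solution of the Painleve equation this is \<open>\<alpha>/4\<close>.\<close>

definition g_fun where
  "g_fun e0 ei k0 p x = - p x * x * ei^2 +
    (4 * e0^2 * x - x * (deriv p x)^2 - 4 * e0 * (k0 + 1) * p x + p x * deriv p x
      + x * p x * deriv (deriv p) x) / (4 * (p x)^3)"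

definition W_centre where
  "W_centre e0 ei k0 s p x = (g_fun e0 ei k0 p x + s * k0 * ei) / (2 * s * ei)"

text \<open>After the first blow-up the branches are z = 0, which stops after one more blow-up, and
  z = - p, which runs through four.\<close>

definition tree_u where
  "tree_u e0 k0 =
    Blowup (\<lambda>p x. (0, 0))
      [Blowup (\<lambda>p x. (0, 0)) [] [],
       Blowup (\<lambda>p x. (0, - p x)) []
         [Blowup (\<lambda>p x. (0, 0)) []
           [Blowup (\<lambda>p x. (A_centre e0 p x, 0)) []
             [Blowup (\<lambda>p x. (a_centre e0 k0 p x, 0)) [] []]]]] []"

definition tree_w where
  "tree_w e0 ei k0 s =
    Blowup (\<lambda>p x. (w_centre e0 ei k0 s p x, 0)) []
      [Blowup (\<lambda>p x. (W_centre e0 ei k0 s p x, 0)) [] []]"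

definition tree_U where
  "tree_U e0 ei k0 =
    Blowup (\<lambda>p x. (0, 0)) []
      [Blowup (\<lambda>p x. (0, 0)) [] [tree_w e0 ei k0 1, tree_w e0 ei k0 (- 1)]]"

section \<open>The centres as functions of x for an arbitrary p\<close>

locale undetermined_function =
  fixes e0 ei k0 :: complex and W :: "complex set" and p :: "complex \<Rightarrow> complex"
  assumes e0: "e0 \<noteq> 0" and ei: "ei \<noteq> 0" and W: "open W" and p_holo: "p holomorphic_on W"
    and x_nonzero: "\<And>x. x \<in> W \<Longrightarrow> x \<noteq> 0" and p_nonzero: "\<And>x. x \<in> W \<Longrightarrow> p x \<noteq> 0"
begin

abbreviation "m \<equiv> bg_m e0 k0 p"
abbreviation "A \<equiv> A_centre e0 p"
abbreviation "a \<equiv> a_centre e0 k0 p"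
abbreviation "w s \<equiv> w_centre e0 ei k0 s p"
abbreviation "\<Omega> s \<equiv> W_centre e0 ei k0 s p"
abbreviation "g \<equiv> g_fun e0 ei k0 p"

lemma p1_holo: "deriv p holomorphic_on W" and p2_holo: "deriv (deriv p) holomorphic_on W"
  using p_holo W by (simp_all add: holomorphic_deriv)

lemma m_holo: "m holomorphic_on W"
  unfolding bg_m_def by (intro holomorphic_intros p_holo p1_holo) (use p_nonzero in auto)

lemma A_holo: "A holomorphic_on W"
  unfolding A_centre_def by (intro holomorphic_intros p_holo) (use e0 x_nonzero in auto)

lemma a_holo: "a holomorphic_on W"
  unfolding a_centre_def by (intro holomorphic_intros p_holo) (use e0 x_nonzero in auto)

lemma w_holo: "w s holomorphic_on W"
  unfolding w_centre_def by (intro holomorphic_intros m_holo) auto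

lemma g_holo: "g holomorphic_on W"
  unfolding g_fun_def by (intro holomorphic_intros p_holo p1_holo p2_holo) (use p_nonzero in auto)

lemma \<Omega>_holo: "s \<noteq> 0 \<Longrightarrow> \<Omega> s holomorphic_on W"
  unfolding W_centre_def by (intro holomorphic_intros g_holo) (use ei in auto)

context
  fixes x assumes x: "x \<in> W"
begin

lemma p_deriv: "(p has_field_derivative deriv p x) (at x)"
  and p1_deriv: "(deriv p has_field_derivative deriv (deriv p) x) (at x)"
  and p2_deriv: "(deriv (deriv p) has_field_derivative deriv (deriv (deriv p)) x) (at x)"
  using holomorphic_derivI[OF _ W x] p_holo p1_holo p2_holo by blast+

lemma deriv_uminus_p: "deriv (\<lambda>x. - p x) x = - deriv p x"
  by (rule DERIV_imp_deriv) (auto intro!: derivative_eq_intros p_deriv)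

lemma deriv_A: "deriv A x = (deriv p x * x - p x) / (e0 * x^2)"
  unfolding A_centre_def
  by (rule DERIV_imp_deriv)
     (use e0 x_nonzero[OF x] in \<open>auto intro!: derivative_eq_intros p_deriv simp: divide_simps power2_eq_square\<close>)

lemma deriv_a: "deriv a x = (1 + k0) * (deriv p x * x - 2 * p x) / (e0^2 * x^3) + 1 / (e0 * x^2)"
proof -
  have "((\<lambda>x. (1 + k0) * p x / (e0 * x)^2 - 1 / (e0 * x)) has_field_derivative
      (1 + k0) * (deriv p x * x - 2 * p x) / (e0^2 * x^3) + 1 / (e0 * x^2)) (at x)"
    apply (rule DERIV_cong)
     apply (rule derivative_eq_intros p_deriv refl | use e0 x_nonzero[OF x] in force)+
    unfolding field_inverse
    using right_inverse[OF e0] right_inverse[OF x_nonzero[OF x]]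
    by (simp del: right_inverse inverse_mult_distrib mult_cancel_left mult_cancel_right) algebra
  moreover have "a = (\<lambda>x. (1 + k0) * p x / (e0 * x)^2 - 1 / (e0 * x))"
    by (auto simp: fun_eq_iff a_centre_def diff_divide_distrib power2_eq_square)
  ultimately show ?thesis using DERIV_imp_deriv by metis
qed

lemma deriv_m: "deriv m x = (2 * e0 - deriv p x - x * deriv (deriv p) x - (2 * k0 + 1) * deriv p x) / (p x)^2
    - 2 * deriv p x * m x / p x"
  unfolding bg_m_def
  apply (rule DERIV_imp_deriv, rule DERIV_cong)
   apply (rule derivative_eq_intros p_deriv p1_deriv refl | use p_nonzero[OF x] in force)+
  unfolding field_inverse
  using right_inverse[OF p_nonzero[OF x]]
  by (simp del: right_inverse inverse_mult_distrib mult_cancel_left mult_cancel_right) algebra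

lemma deriv_w: "deriv (w s) x = deriv m x / 4 + s * ei / 2"
proof -
  have "(m has_field_derivative deriv m x) (at x)" using holomorphic_derivI[OF m_holo W x] .
  then show ?thesis
    unfolding w_centre_def by (intro DERIV_imp_deriv) (auto intro!: derivative_eq_intros)
qed

lemma deriv_\<Omega>: "s \<noteq> 0 \<Longrightarrow> deriv (\<Omega> s) x = deriv g x / (2 * s * ei)"
proof -
  assume "s \<noteq> 0"
  have "(g has_field_derivative deriv g x) (at x)" using holomorphic_derivI[OF g_holo W x] .
  then show ?thesis using \<open>s \<noteq> 0\<close> ei
    unfolding W_centre_def by (intro DERIV_imp_deriv) (auto intro!: derivative_eq_intros)
qed

text \<open>These are the hypotheses of the lemmas at fixed x, in their order, for K = 2 k0 + 1, X =
  2 e0 x and r = 1 + k0. The last one is the resonance condition; no equation for p enters its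
  proof.\<close>

lemma relations:
  "x \<noteq> 0" "p x \<noteq> 0" "2 * e0 * x \<noteq> 0"
  "m x * (p x)^2 = 2 * e0 * x - x * deriv p x - (2 * k0 + 1) * p x"
  "2 * e0 * x * A x = 2 * p x"
  "m x * p x * A x + x * deriv A x + 2 * e0 * x * a x = 0"
  "2 + 2 * e0 * x * a x = 2 * (1 + k0) * A x"
  "(2 * k0 + 1) * a x - m x * p x * a x - m x * A x - 4 * (1 + k0) * a x = x * deriv a x"
proof -
  note inv = right_inverse[OF e0] right_inverse[OF x_nonzero[OF x]] right_inverse[OF p_nonzero[OF x]]
  show "x \<noteq> 0" "p x \<noteq> 0" "2 * e0 * x \<noteq> 0" using e0 x_nonzero[OF x] p_nonzero[OF x] by auto
  show "m x * (p x)^2 = 2 * e0 * x - x * deriv p x - (2 * k0 + 1) * p x"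
    using p_nonzero[OF x] by (simp add: bg_m_def algebra_simps)
  show "2 * e0 * x * A x = 2 * p x"
    using e0 x_nonzero[OF x] by (simp add: A_centre_def)
  show "m x * p x * A x + x * deriv A x + 2 * e0 * x * a x = 0"
    unfolding deriv_A bg_m_def A_centre_def a_centre_def field_inverse using inv by algebra
  show "2 + 2 * e0 * x * a x = 2 * (1 + k0) * A x"
    unfolding A_centre_def a_centre_def field_inverse using inv(1,2) by algebra
  show "(2 * k0 + 1) * a x - m x * p x * a x - m x * A x - 4 * (1 + k0) * a x = x * deriv a x"
    unfolding deriv_a bg_m_def A_centre_def a_centre_def field_inverse using inv by algebra
qed

text \<open>Here p'' enters only through the derivative of m. In this form g can be recognised both
  in the equation for \<Omega> and in the transformed Hamiltonian system.\<close>

lemma x_times_g: "x * g x = - p x * ((x * ei)^2 - (m x)^2 / 4) + (2 * k0 + 1) * m x / 4 - x * deriv m x / 4"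
  unfolding deriv_m g_fun_def bg_m_def field_inverse using right_inverse[OF p_nonzero[OF x]] by algebra

text \<open>The hypotheses of the cascade at \<open>w s\<close> with h = s x ei; E is the same for
  both signs as s^2 = 1. In the last equation the mixed terms in m and s cancel, the part free of s
  is x g by \<open>x_times_g\<close>, and the part linear in s is s x ei (K - 1)/2 = s x ei
  k0.\<close>

lemma relations_w:
  assumes "s = 1 \<or> s = - 1"
  shows "s * (x * ei) \<noteq> 0" "4 * w s x = m x + 2 * (s * (x * ei))"
    "(x * ei)^2 - (m x)^2 / 4 = (s * (x * ei))^2 - (m x)^2 / 4"
    "(2 * m x * p x + (2 * k0 + 1)) * w s x - 4 * p x * (w s x)^2 - x * deriv (w s) x
      = 2 * (s * (x * ei)) * \<Omega> s x"
proof -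
  note inv = right_inverse[OF ei] right_inverse[OF p_nonzero[OF x]]
  have s: "s * s = 1" "inverse s = s" using assms by auto
  show "s * (x * ei) \<noteq> 0" using s ei x_nonzero[OF x] by auto
  show "4 * w s x = m x + 2 * (s * (x * ei))" by (simp add: w_centre_def algebra_simps)
  show "(x * ei)^2 - (m x)^2 / 4 = (s * (x * ei))^2 - (m x)^2 / 4" using s by algebra
  have *: "2 * (s * (x * ei)) * \<Omega> s x = x * (g x + s * k0 * ei)"
    using s ei by (auto simp: W_centre_def)
  show "(2 * m x * p x + (2 * k0 + 1)) * w s x - 4 * p x * (w s x)^2 - x * deriv (w s) x
      = 2 * (s * (x * ei)) * \<Omega> s x"
    unfolding * deriv_w w_centre_def distrib_left[of x "g x"] x_times_g
    using assms by (elim disjE) (simp_all add: algebra_simps power2_eq_square add_divide_distrib diff_divide_distrib)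
qed

end

section \<open>Assembling the trees from the leaves to the roots\<close>

abbreviation "SB0 \<equiv> chart_u0v0 (bg_system e0 ei k0 p)"
abbreviation "SB1 \<equiv> blowup_uv (\<lambda>x. 0) (\<lambda>x. 0) SB0"
abbreviation "SC1 \<equiv> blowup_UV (\<lambda>x. 0) (\<lambda>x. - p x) SB1"
abbreviation "SD1 \<equiv> blowup_UV (\<lambda>x. 0) (\<lambda>x. 0) SC1"
abbreviation "SE1 \<equiv> blowup_UV A (\<lambda>x. 0) SD1"
abbreviation "SG0 \<equiv> chart_U0V0 (bg_system e0 ei k0 p)"
abbreviation "SG1 \<equiv> blowup_UV (\<lambda>x. 0) (\<lambda>x. 0) SG0"
abbreviation "SG2 \<equiv> blowup_UV (\<lambda>x. 0) (\<lambda>x. 0) SG1"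
abbreviation "SG3 s \<equiv> blowup_UV (w s) (\<lambda>x. 0) SG2"

lemma bg_at: "x \<in> W \<Longrightarrow> bg_system e0 ei k0 p x = fA x (p x) (m x) ((x * ei)^2 - (m x)^2 / 4) (2 * k0 + 1)"
  using bg_system_at relations(1,2) by blast

lemmas at_simps = in_base_points in_regular_points system_at bg_at deriv_uminus_p

lemma process_Z: "blowup_process W p SB1 (Blowup (\<lambda>p x. (0, 0)) [] [])"
  by (auto simp: Let_def cascade_ends_def base_points_within_def at_simps
      base_B1[OF relations(1,2)] not_base_Z[OF relations(1,2)] not_base_Z'[OF relations(1,2)])

lemma regular_Z: "regular_cascades W p SB1 (Blowup (\<lambda>p x. (0, 0)) [] [])"
  by (auto simp: Let_def regular_on_last_curve_def at_simps reg_Z[OF relations(1,2)])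

lemma process_a: "blowup_process W p SE1 (Blowup (\<lambda>p x. (a_centre e0 k0 p x, 0)) [] [])"
  using a_holo
  by (auto simp: Let_def cascade_ends_def base_points_within_def at_simps
      base_E1[OF relations] not_base_F1[OF relations] not_base_F1'[OF relations])

lemma regular_a: "regular_cascades W p SE1 (Blowup (\<lambda>p x. (a_centre e0 k0 p x, 0)) [] [])"
  by (auto simp: Let_def regular_on_last_curve_def at_simps reg_F1[OF relations])

text \<open>A single x with nonzero derivative spoils both final charts, while a vanishing
  derivative makes the chart (U, V) regular along the whole curve.\<close>

lemma regular_on_last_curve_\<Omega>:
  assumes "s = 1 \<or> s = - 1"
  shows "regular_on_last_curve W (blowup_uv (\<Omega> s) (\<lambda>x. 0) (SG3 s)) (blowup_UV (\<Omega> s) (\<lambda>x. 0) (SG3 s)) \<longleftrightarrow>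
    (\<forall>x\<in>W. deriv (\<Omega> s) x = 0)"
proof
  note rel = relations(1,2) relations_w[OF _ assms]
  assume reg: "regular_on_last_curve W (blowup_uv (\<Omega> s) (\<lambda>x. 0) (SG3 s)) (blowup_UV (\<Omega> s) (\<lambda>x. 0) (SG3 s))"
  show "\<forall>x\<in>W. deriv (\<Omega> s) x = 0"
  proof (intro ballI, rule ccontr)
    fix x assume x: "x \<in> W" and nz: "deriv (\<Omega> s) x \<noteq> 0"
    show False
      using reg x not_reg_G4[OF rel, OF x x x x x x nz] not_reg_G4'[OF rel, OF x x x x x x nz]
      by (auto simp: regular_on_last_curve_def at_simps)
  qed
next
  note rel = relations(1,2) relations_w[OF _ assms]
  assume "\<forall>x\<in>W. deriv (\<Omega> s) x = 0"
  then show "regular_on_last_curve W (blowup_uv (\<Omega> s) (\<lambda>x. 0) (SG3 s)) (blowup_UV (\<Omega> s) (\<lambda>x. 0) (SG3 s))"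
    using reg_G4[OF rel] by (auto simp: regular_on_last_curve_def at_simps)
qed

text \<open>The chart (U, V) never has an indeterminacy here. For the chart (u, v) regularity is
  first converted into the vanishing of the derivative.\<close>

lemma process_\<Omega>:
  assumes "s = 1 \<or> s = - 1"
  shows "blowup_process W p (SG3 s) (Blowup (\<lambda>p x. (W_centre e0 ei k0 s p x, 0)) [] [])"
proof -
  note rel = relations(1,2) relations_w[OF _ assms]
  have "s \<noteq> 0" using assms by auto
  have "deriv (\<Omega> s) x = 0" if "regular_on_last_curve W (blowup_uv (\<Omega> s) (\<lambda>x. 0) (SG3 s)) (blowup_UV (\<Omega> s) (\<lambda>x. 0) (SG3 s))" "x \<in> W" for x
    using that regular_on_last_curve_\<Omega>[OF assms] by blast
  then show ?thesis
  using \<Omega>_holo[OF \<open>s \<noteq> 0\<close>]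
  by (auto simp: Let_def cascade_ends_def base_points_within_def at_simps
      base_G3[OF rel] not_base_G4[OF rel] not_base_G4'[OF rel])
qed

lemma regular_\<Omega>:
  assumes "s = 1 \<or> s = - 1"
  shows "regular_cascades W p (SG3 s) (Blowup (\<lambda>p x. (W_centre e0 ei k0 s p x, 0)) [] []) \<longleftrightarrow>
    (\<forall>x\<in>W. deriv g x = 0)"
proof -
  note rel = relations(1,2) relations_w[OF _ assms]
  have s: "s \<noteq> 0" using assms by auto
  have d: "deriv (\<Omega> s) x = 0 \<longleftrightarrow> deriv g x = 0" if "x \<in> W" for x
    using deriv_\<Omega>[OF that s] s ei by simp
  show ?thesis using d regular_on_last_curve_\<Omega>[OF assms] by (simp add: Let_def)
qed

abbreviation "tree_a \<equiv> Blowup (\<lambda>p x. (a_centre e0 k0 p x, 0)) [] []"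
abbreviation "tree_A \<equiv> Blowup (\<lambda>p x. (A_centre e0 p x, 0)) [] [tree_a]"
abbreviation "tree_s \<equiv> Blowup (\<lambda>p x. (0, 0)) [] [tree_A]"
abbreviation "tree_t \<equiv> Blowup (\<lambda>p x. (0, - p x)) [] [tree_s]"

lemma process_A: "blowup_process W p SD1 tree_A"
proof -
  have "\<forall>x\<in>W. base_points_within (blowup_uv A (\<lambda>x. 0) SD1) SE1 x {} {a x}"
    unfolding base_points_within_def
  proof (intro ballI conjI allI impI)
    fix x v assume x: "x \<in> W" and "(0, v) \<in> base_points (blowup_uv A (\<lambda>x. 0) SD1) x"
    then show "v \<in> {} \<or> (\<exists>U\<in>{a x}. U * v = 1)"
      using not_base_E1'[OF relations, OF x x x x x x x x] by (auto simp: at_simps)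
  next
    fix x U assume x: "x \<in> W" and "(U, 0) \<in> base_points SE1 x"
    then show "U \<in> {a x} \<or> (\<exists>v\<in>{}. U * v = 1)"
      using not_base_E1[OF relations, OF x x x x x x x x] by (auto simp: at_simps)
  qed
  then show ?thesis
    using A_holo process_a base_D1[OF relations]
    by (simp add: Let_def at_simps)
qed

lemma process_s: "blowup_process W p SC1 tree_s"
proof -
  have "\<forall>x\<in>W. base_points_within (blowup_uv (\<lambda>x. 0) (\<lambda>x. 0) SC1) SD1 x {} {A x}"
    unfolding base_points_within_def
  proof (intro ballI conjI allI impI)
    fix x v assume x: "x \<in> W" and "(0, v) \<in> base_points (blowup_uv (\<lambda>x. 0) (\<lambda>x. 0) SC1) x"
    then have "2 * e0 * x = 2 * p x * v"
      using not_base_D1'[OF relations(1-4), OF x x x x] by (auto simp: at_simps)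
    \<comment> \<open>The candidate v is the reciprocal of \<open>A x\<close>, that is, the listed
      point seen from the other chart.\<close>
    then have "A x * v = (e0 * x) / (e0 * x)" by (simp add: A_centre_def)
    then show "v \<in> {} \<or> (\<exists>U\<in>{A x}. U * v = 1)"
      using relations(1)[OF x] e0 by simp
  next
    fix x U assume x: "x \<in> W" and "(U, 0) \<in> base_points SD1 x"
    then have "2 * p x = 2 * e0 * x * U"
      using not_base_D1[OF relations(1-4), OF x x x x] by (auto simp: at_simps)
    then show "U \<in> {A x} \<or> (\<exists>v\<in>{}. U * v = 1)"
      using relations(1)[OF x] e0 by (simp add: A_centre_def)
  qed
  then show ?thesis
    using process_A base_C1[OF relations(1-4)]
    by (simp add: Let_def at_simps del: blowup_process.simps add: blowup_process.simps[of W p SC1])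
qed

lemma process_t: "blowup_process W p SB1 tree_t"
proof -
  have "\<forall>x\<in>W. base_points_within (blowup_uv (\<lambda>x. 0) (\<lambda>x. - p x) SB1) SC1 x {} {0}"
    unfolding base_points_within_def
  proof (intro ballI conjI allI impI)
    fix x v assume x: "x \<in> W" and "(0, v) \<in> base_points (blowup_uv (\<lambda>x. 0) (\<lambda>x. - p x) SB1) x"
    then show "v \<in> {} \<or> (\<exists>U\<in>{0}. U * v = 1)"
      using not_base_C1'[OF relations(1-4), OF x x x x] by (auto simp: at_simps)
  next
    fix x U assume x: "x \<in> W" and "(U, 0) \<in> base_points SC1 x"
    then show "U \<in> {0} \<or> (\<exists>v\<in>{}. U * v = 1)"
      using not_base_C1[OF relations(1-4), OF x x x x] by (auto simp: at_simps)
  qed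
  then show ?thesis
    using process_s base_B1[OF relations(1,2)] p_holo
    by (simp add: Let_def at_simps holomorphic_on_minus del: blowup_process.simps add: blowup_process.simps[of W p SB1])
qed

lemma process_u: "blowup_process W p SB0 (tree_u e0 k0)"
proof -
  have "\<forall>x\<in>W. base_points_within SB1 (blowup_UV (\<lambda>x. 0) (\<lambda>x. 0) SB0) x {0, - p x} {}"
    unfolding base_points_within_def
  proof (intro ballI conjI allI impI)
    fix x v assume x: "x \<in> W" and "(0, v) \<in> base_points SB1 x"
    then show "v \<in> {0, - p x} \<or> (\<exists>U\<in>{}. U * v = 1)"
      using not_base_B1[OF relations(1,2), OF x x] by (auto simp: at_simps)
  next
    fix x U assume x: "x \<in> W" and "(U, 0) \<in> base_points (blowup_UV (\<lambda>x. 0) (\<lambda>x. 0) SB0) x"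
    then have "1 + p x * U = 0"
      using not_base_B1'[OF relations(1,2), OF x x] by (auto simp: at_simps)
    then have "U * (- p x) = 1" by algebra
    then show "U \<in> {} \<or> (\<exists>v\<in>{0, - p x}. U * v = 1)" by blast
  qed
  then show ?thesis
    unfolding tree_u_def
    using process_t process_Z base_B0[OF relations(1,2)]
    by (simp add: Let_def at_simps del: blowup_process.simps add: blowup_process.simps[of W p SB0])
qed

lemma process_w:
  assumes "s = 1 \<or> s = - 1"
  shows "blowup_process W p SG2 (tree_w e0 ei k0 s)"
proof -
  note rel = relations(1,2) relations_w[OF _ assms]
  have "\<forall>x\<in>W. base_points_within (blowup_uv (w s) (\<lambda>x. 0) SG2) (SG3 s) x {} {\<Omega> s x}"
    unfolding base_points_within_def
  proof (intro ballI conjI allI impI)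
    fix x v assume x: "x \<in> W" and "(0, v) \<in> base_points (blowup_uv (w s) (\<lambda>x. 0) SG2) x"
    then show "v \<in> {} \<or> (\<exists>U\<in>{\<Omega> s x}. U * v = 1)"
      using not_base_G3'[OF rel, OF x x x x x x] by (auto simp: at_simps)
  next
    fix x U assume x: "x \<in> W" and "(U, 0) \<in> base_points (SG3 s) x"
    then show "U \<in> {\<Omega> s x} \<or> (\<exists>v\<in>{}. U * v = 1)"
      using not_base_G3[OF rel, OF x x x x x x] by (auto simp: at_simps)
  qed
  then show ?thesis
    unfolding tree_w_def
    using process_\<Omega>[OF assms] base_G2[OF rel] w_holo
    by (simp add: Let_def at_simps del: blowup_process.simps add: blowup_process.simps[of W p SG2])
qed

lemma process_U: "blowup_process W p SG0 (tree_U e0 ei k0)"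
proof -
  \<comment> \<open>Factoring the quadratic shows that the two centres exhaust its zeros.\<close>
  have w: "(x * ei)^2 - (m x)^2 / 4 + 2 * m x * y - 4 * y^2 = - 4 * (y - w 1 x) * (y - w (- 1) x)" for x y
    unfolding w_centre_def by algebra
  have "\<forall>x\<in>W. base_points_within (blowup_uv (\<lambda>x. 0) (\<lambda>x. 0) SG1) SG2 x {} {w 1 x, w (- 1) x}"
    unfolding base_points_within_def
  proof (intro ballI conjI allI impI)
    fix x v assume x: "x \<in> W" and "(0, v) \<in> base_points (blowup_uv (\<lambda>x. 0) (\<lambda>x. 0) SG1) x"
    then have v: "v^2 * ((x * ei)^2 - (m x)^2 / 4) + 2 * m x * v = 4"
      using not_base_G2'[OF relations(1,2), OF x x] by (auto simp: at_simps)
    \<comment> \<open>The same factorisation in the reciprocal coordinate v = 1/w.\<close>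
    have "v^2 * ((x * ei)^2 - (m x)^2 / 4) + 2 * m x * v - 4 = - 4 * (1 - w 1 x * v) * (1 - w (- 1) x * v)"
      unfolding w_centre_def by algebra
    then show "v \<in> {} \<or> (\<exists>U\<in>{w 1 x, w (- 1) x}. U * v = 1)" using v by simp
  next
    fix x U assume x: "x \<in> W" and "(U, 0) \<in> base_points SG2 x"
    then have "(x * ei)^2 - (m x)^2 / 4 + 2 * m x * U - 4 * U^2 = 0"
      using not_base_G2[OF relations(1,2), OF x x] by (auto simp: at_simps)
    then show "U \<in> {w 1 x, w (- 1) x} \<or> (\<exists>v\<in>{}. U * v = 1)" using w[of x U] by auto
  qed
  moreover have "\<forall>x\<in>W. base_points_within (blowup_uv (\<lambda>x. 0) (\<lambda>x. 0) SG0) SG1 x {} {0}"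
    unfolding base_points_within_def
  proof (intro ballI conjI allI impI)
    fix x v assume x: "x \<in> W" and "(0, v) \<in> base_points (blowup_uv (\<lambda>x. 0) (\<lambda>x. 0) SG0) x"
    then show "v \<in> {} \<or> (\<exists>U\<in>{0}. U * v = 1)"
      using not_base_G1'[OF relations(1,2), OF x x] by (auto simp: at_simps)
  next
    fix x U assume x: "x \<in> W" and "(U, 0) \<in> base_points SG1 x"
    then show "U \<in> {0} \<or> (\<exists>v\<in>{}. U * v = 1)"
      using not_base_G1[OF relations(1,2), OF x x] by (auto simp: at_simps)
  qed
  ultimately show ?thesis
    using process_w[of 1] process_w[of "- 1"] base_G0[OF relations(1,2)] base_G1[OF relations(1,2)]
    by (simp add: tree_U_def tree_w_def Let_def at_simps
        del: blowup_process.simps add: blowup_process.simps[of W p SG0] blowup_process.simps[of W p SG1])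
qed

text \<open>The affine chart has no base points, and in each of the other two charts only the origin
  is one: [0:1:0] and [0:0:1]. Hence two trees suffice.\<close>

lemma regularisation_process_bg:
  "regularisation_process W p (bg_system e0 ei k0 p) ([], [tree_u e0 k0], [tree_U e0 ei k0])"
proof -
  have "\<not> base_at (bg_system e0 ei k0 p x) y z" if "x \<in> W" for x y z
    using not_base_A[OF relations(1,2), OF that that] that by (simp add: bg_at)
  moreover have "u = 0 \<and> v = 0" if x: "x \<in> W" and "base_at (SB0 x) u v" for x u v
    using that(2) not_base_B0[OF relations(1,2), OF x x] unfolding system_at bg_at[OF x] by blast
  moreover have "U = 0 \<and> V = 0" if x: "x \<in> W" and "base_at (SG0 x) U V" for x U V
    using that(2) not_base_G0[OF relations(1,2), OF x x] unfolding system_at bg_at[OF x] by blast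
  ultimately show ?thesis
    using process_u process_U
    by (fastforce simp: regularisation_process_def same_point_def hom_u0v0_def hom_U0V0_def in_base_points
        tree_u_def tree_U_def simp del: blowup_process.simps intro!: exI[of _ "1::complex"])
qed

text \<open>All leaves except the two over [0:0:1] are regular for every p, and these two impose the
  same condition, since the two functions \<Omega> differ from multiples of g by constants.\<close>

lemma regularised_bg:
  "regularised W p (bg_system e0 ei k0 p) ([], [tree_u e0 k0], [tree_U e0 ei k0]) \<longleftrightarrow>
    (\<forall>x\<in>W. deriv g x = 0)"
  using regular_Z regular_a regular_\<Omega>[of 1] regular_\<Omega>[of "- 1"]
  by (simp add: regularised_def tree_u_def tree_U_def tree_w_def Let_def)

end

section \<open>The regularising condition\<close>

abbreviation (input) dp_minus (infixl "\<ominus>\<ominus>" 65) where "dp_minus E F \<equiv> Plus E (Times (Const (- 1)) F)"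
abbreviation (input) dp_plus (infixl "\<oplus>\<oplus>" 65) where "dp_plus \<equiv> Plus"
abbreviation (input) dp_times (infixl "\<otimes>\<otimes>" 70) where "dp_times \<equiv> Times"

text \<open>This is \<open>4 p ^ 4\<close> times the derivative of \<^const>\<open>g_fun\<close>.\<close>

definition bg_condition :: "complex \<Rightarrow> complex \<Rightarrow> complex \<Rightarrow> diff_poly" where
  "bg_condition e0 ei k0 =
    (let p = Der 0; p1 = Der 1; p2 = Der 2; p3 = Der 3;
         \<beta> = Const (4 * e0 * (k0 + 1)); \<eta> = Const (4 * e0^2);
         N = \<eta> \<otimes>\<otimes> Indep \<ominus>\<ominus> Indep \<otimes>\<otimes> p1 \<otimes>\<otimes> p1 \<ominus>\<ominus> \<beta> \<otimes>\<otimes> p \<oplus>\<oplus> p \<otimes>\<otimes> p1 \<oplus>\<oplus> Indep \<otimes>\<otimes> p \<otimes>\<otimes> p2;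
         N1 = \<eta> \<ominus>\<ominus> Indep \<otimes>\<otimes> p1 \<otimes>\<otimes> p2 \<ominus>\<ominus> \<beta> \<otimes>\<otimes> p1 \<oplus>\<oplus> Const 2 \<otimes>\<otimes> p \<otimes>\<otimes> p2 \<oplus>\<oplus> Indep \<otimes>\<otimes> p \<otimes>\<otimes> p3
     in p \<otimes>\<otimes> N1 \<ominus>\<ominus> Const 3 \<otimes>\<otimes> p1 \<otimes>\<otimes> N
        \<ominus>\<ominus> Const (4 * ei^2) \<otimes>\<otimes> p \<otimes>\<otimes> p \<otimes>\<otimes> p \<otimes>\<otimes> p \<otimes>\<otimes> (p \<oplus>\<oplus> Indep \<otimes>\<otimes> p1))"

context undetermined_function
begin

lemma deriv_g:
  assumes x: "x \<in> W"
  shows "4 * (p x)^4 * deriv g x = dp_eval (bg_condition e0 ei k0) p x"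
proof -
  let ?p = "p x" and ?p1 = "deriv p x" and ?p2 = "deriv (deriv p) x" and ?p3 = "deriv (deriv (deriv p)) x"
  \<comment> \<open>N is the numerator of the fraction in \<open>g_fun\<close>, and N' below is its
    derivative.\<close>
  define N where "N x = 4 * e0^2 * x - x * (deriv p x)^2 - 4 * e0 * (k0 + 1) * p x + p x * deriv p x
      + x * p x * deriv (deriv p) x" for x
  define N' where "N' = 4 * e0^2 - x * ?p1 * ?p2 - 4 * e0 * (k0 + 1) * ?p1 + 2 * ?p * ?p2 + x * ?p * ?p3"
  note d = p_deriv[OF x] p1_deriv[OF x] p2_deriv[OF x]
  have N: "(N has_field_derivative N') (at x)"
    unfolding N_def[abs_def] N'_def
    by (auto intro!: derivative_eq_intros d) (simp add: algebra_simps power2_eq_square)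
  have "((\<lambda>x. - p x * x * ei^2 + N x / (4 * (p x)^3)) has_field_derivative
      (- (?p1 * x + ?p) * ei^2 + (N' * ?p^3 - N x * (3 * ?p^2 * ?p1)) / (4 * (?p^3 * ?p^3)))) (at x)"
  proof (rule DERIV_cong)
    show "((\<lambda>x. - p x * x * ei^2 + N x / (4 * (p x)^3)) has_field_derivative
      (- (?p1 * x + ?p) * ei^2 + (N' * (4 * ?p^3) - N x * (12 * ?p^2 * ?p1)) / (4 * ?p^3 * (4 * ?p^3)))) (at x)"
      by (rule derivative_eq_intros N d refl)+ (use p_nonzero[OF x] in \<open>simp_all add: algebra_simps\<close>)
    have "(N' * (4 * ?p^3) - N x * (12 * ?p^2 * ?p1)) / (4 * ?p^3 * (4 * ?p^3)) =
      (4 * (N' * ?p^3 - N x * (3 * ?p^2 * ?p1))) / (4 * (4 * (?p^3 * ?p^3)))"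
      by (simp add: algebra_simps)
    also have "\<dots> = (N' * ?p^3 - N x * (3 * ?p^2 * ?p1)) / (4 * (?p^3 * ?p^3))"
      by (rule mult_divide_mult_cancel_left) simp
    finally show "- (?p1 * x + ?p) * ei^2 + (N' * (4 * ?p^3) - N x * (12 * ?p^2 * ?p1)) / (4 * ?p^3 * (4 * ?p^3)) =
      - (?p1 * x + ?p) * ei^2 + (N' * ?p^3 - N x * (3 * ?p^2 * ?p1)) / (4 * (?p^3 * ?p^3))"
      by simp
  qed
  then have g: "deriv g x = - (?p1 * x + ?p) * ei^2 + (N' * ?p^3 - N x * (3 * ?p^2 * ?p1)) / (4 * (?p^3 * ?p^3))"
    unfolding N_def g_fun_def[abs_def] by (rule DERIV_imp_deriv)
  have "4 * ?p^4 * deriv g x = - 4 * ei^2 * ?p^4 * (?p + x * ?p1) + ?p * N' - 3 * ?p1 * N x"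
    unfolding g field_inverse using right_inverse[OF p_nonzero[OF x]] by algebra
  also have "\<dots> = dp_eval (bg_condition e0 ei k0) p x"
    unfolding N_def N'_def bg_condition_def Let_def
    by (simp add: numeral_2_eq_2 numeral_3_eq_3) algebra
  finally show ?thesis .
qed

text \<open>Substituting the equation for p'' cancels everything in the numerator of
  \<open>g_fun\<close> except \<alpha> p^3 + 4 ei^2 x p^4; the second term is offset by - p x ei^2,
  which leaves the constant \<alpha>/4.\<close>

lemma g_P3:
  assumes P3: "\<forall>x\<in>W. deriv (deriv p) x =
    P3D6_rhs (- 4 * ei * ki) (4 * e0 * (k0 + 1)) (4 * ei^2) (- 4 * e0^2) x (p x) (deriv p x)"
    and x: "x \<in> W"
  shows "g x = - ei * ki" and "deriv g x = 0"
proof -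
  have g: "g y = - ei * ki" if y: "y \<in> W" for y
    unfolding g_fun_def P3[rule_format, OF y] P3D6_rhs_def field_inverse
    using right_inverse[OF p_nonzero[OF y]] right_inverse[OF x_nonzero[OF y]] by algebra
  then show "g x = - ei * ki" using x .
  from g have "((\<lambda>y. - ei * ki) has_field_derivative deriv g x) (at x)"
    using holomorphic_derivI[OF g_holo W x] has_field_derivative_transform_within_open[OF _ W x, of g] by simp
  then show "deriv g x = 0" using DERIV_const DERIV_unique by blast
qed

end

lemma undetermined_functionI:
  assumes "undetermined P3D6_dom W p" "e0 \<noteq> 0" "ei \<noteq> 0"
  shows "undetermined_function e0 ei W p"
  using assms unfolding undetermined_def undetermined_function_def P3D6_dom_def by auto

lemma obtained_as_regularising_condition_bg:
  assumes e: "e0 \<noteq> 0" "ei \<noteq> 0"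
  shows "obtained_as_regularising_condition P3D6_dom
    (P3D6_rhs (- 4 * ei * ki) (4 * e0 * (k0 + 1)) (4 * ei^2) (- 4 * e0^2)) (bg_system e0 ei k0)"
  unfolding obtained_as_regularising_condition_def
proof (intro exI[of _ "([], [tree_u e0 k0], [tree_U e0 ei k0])"] exI[of _ "[bg_condition e0 ei k0]"] conjI allI impI)
  fix W p assume "undetermined P3D6_dom W p"
  then interpret undetermined_function e0 ei k0 W p by (rule undetermined_functionI[OF _ e])
  have iff: "(\<forall>x\<in>W. deriv g x = 0) \<longleftrightarrow> (\<forall>E\<in>set [bg_condition e0 ei k0]. \<forall>x\<in>W. dp_eval E p x = 0)"
    using deriv_g p_nonzero by (auto simp flip: deriv_g)
  show "regularisation_process W p (bg_system e0 ei k0 p) ([], [tree_u e0 k0], [tree_U e0 ei k0])"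
    by (rule regularisation_process_bg)
  show "regularised W p (bg_system e0 ei k0 p) ([], [tree_u e0 k0], [tree_U e0 ei k0]) \<longleftrightarrow>
      (\<forall>E\<in>set [bg_condition e0 ei k0]. \<forall>x\<in>W. dp_eval E p x = 0)"
    unfolding regularised_bg iff ..
  show "\<forall>E\<in>set [bg_condition e0 ei k0]. \<forall>x\<in>W. dp_eval E p x = 0"
    if "\<forall>x\<in>W. deriv (deriv p) x = P3D6_rhs (- 4 * ei * ki) (4 * e0 * (k0 + 1)) (4 * ei^2) (- 4 * e0^2) x (p x) (deriv p x)"
    using g_P3(2)[OF that] iff by blast
next
  \<comment> \<open>A constant function c violates the condition at x = 1 as soon as e0^2 differs
    from ei^2 c^4. One of the values 1 and 2 always works, and the ball of radius 1 about 1 avoids x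
    = 0.\<close>
  define c :: complex where "c = (if e0^2 = ei^2 then 2 else 1)"
  have c: "c \<noteq> 0" "e0^2 \<noteq> ei^2 * c^4" using e by (auto simp: c_def)
  have d: "(deriv ^^ Suc n) (\<lambda>x::complex. c) = (\<lambda>x. 0)" for n by (induction n) (simp_all add: fun_eq_iff)
  show "\<exists>W p. undetermined P3D6_dom W p \<and> \<not> (\<forall>E\<in>set [bg_condition e0 ei k0]. \<forall>x\<in>W. dp_eval E p x = 0)"
  proof (intro exI conjI)
    show "undetermined P3D6_dom (ball 1 1) (\<lambda>x. c)"
      using c by (auto simp: undetermined_def P3D6_dom_def dist_norm)
    have "dp_eval (bg_condition e0 ei k0) (\<lambda>x. c) 1 = 4 * c * (e0^2 - ei^2 * c^4)"
      unfolding bg_condition_def Let_def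
      using d[of 0] d[of 1] d[of 2] by (simp add: numeral_2_eq_2 numeral_3_eq_3 del: funpow.simps(2)) algebra
    then show "\<not> (\<forall>E\<in>set [bg_condition e0 ei k0]. \<forall>x\<in>ball 1 1. dp_eval E (\<lambda>x. c) x = 0)"
      using c by (auto intro!: bexI[of _ 1])
  qed
qed

section \<open>The transformation to the Hamiltonian system\<close>

lemma hamiltonian_system_okamoto:
  assumes "x \<noteq> 0"
  shows "hamiltonian_system (okamoto_hamiltonian e0 ei k0 ki) x y z =
    ((4 * y^2 * z - 2 * ei * x * y^2 + 2 * e0 * x - (2 * k0 + 1) * y) / x,
     (- 4 * y * z^2 - ei * (k0 + ki) * x + z * (4 * ei * x * y + (2 * k0 + 1))) / x)"
proof -
  let ?H = "okamoto_hamiltonian e0 ei k0 ki x"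
  have "((\<lambda>w. ?H y w) has_field_derivative
      (4 * y^2 * z - 2 * ei * x * y^2 + 2 * e0 * x - (2 * k0 + 1) * y) / x) (at z)"
    unfolding okamoto_hamiltonian_def using assms
    by (auto intro!: derivative_eq_intros)
  moreover have "((\<lambda>w. ?H w z) has_field_derivative
      - ((- 4 * y * z^2 - ei * (k0 + ki) * x + z * (4 * ei * x * y + (2 * k0 + 1))) / x)) (at y)"
    unfolding okamoto_hamiltonian_def using assms
    by (auto intro!: derivative_eq_intros) (simp add: algebra_simps diff_divide_distrib add_divide_distrib power2_eq_square)
  ultimately show ?thesis
    unfolding hamiltonian_system_def by (simp add: DERIV_imp_deriv)
qed

context undetermined_function
begin

abbreviation "c x \<equiv> x * ei / 2 - m x / 4"

lemma c_deriv: "x \<in> W \<Longrightarrow> (c has_field_derivative (ei / 2 - deriv m x / 4)) (at x)"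
  using holomorphic_derivI[OF m_holo W] by (auto intro!: derivative_eq_intros)

text \<open>This is the chain rule for y3 = z + p, z3 = y z + c. The first identity rests on the
  definition of m alone; the second also uses g = - ei ki, which is how the Painleve equation enters
  the equivalence.\<close>

lemma okamoto_bg:
  assumes x: "x \<in> W" and g: "g x = - ei * ki"
  defines "T \<equiv> hamiltonian_system (okamoto_hamiltonian e0 ei k0 ki)" and "S \<equiv> bg_system e0 ei k0 p"
  shows "fst (T x (z + p x) (y * z + c x)) = snd (S x y z) + deriv p x"
    "snd (T x (z + p x) (y * z + c x)) = fst (S x y z) * z + y * snd (S x y z) + (ei / 2 - deriv m x / 4)"
proof -
  note inv = right_inverse[OF x_nonzero[OF x]]
  note rel = relations(1,2,4)[OF x]
  show "fst (T x (z + p x) (y * z + c x)) = snd (S x y z) + deriv p x"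
    unfolding T_def S_def hamiltonian_system_okamoto[OF rel(1)] bg_at[OF x] fA_def[OF rel(1,2)] fst_conv snd_conv field_inverse
    using inv rel(3) by algebra
  show "snd (T x (z + p x) (y * z + c x)) = fst (S x y z) * z + y * snd (S x y z) + (ei / 2 - deriv m x / 4)"
  proof -
    \<comment> \<open>Halves and quarters are absorbed into new variables, so that
      \<open>algebra\<close> meets integer coefficients only.\<close>
    define h M U where hMU_def: "h = ei / 2" "M = m x / 4" "U = deriv m x / 4"
    have hMU: "ei = 2 * h" "m x = 4 * M" "deriv m x = 4 * U" unfolding hMU_def by simp_all
    have U: "x * (- (2 * h) * ki) = - p x * ((x * (2 * h))^2 - 4 * M^2) + (2 * k0 + 1) * M - x * U"
      using x_times_g[OF x, unfolded g] unfolding hMU by (simp add: power_mult_distrib)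
    have "(- 4 * (z + p x) * (y * z + (x * h - M))^2 - 2 * h * (k0 + ki) * x
        + (y * z + (x * h - M)) * (4 * (2 * h) * x * (z + p x) + (2 * k0 + 1))) * inverse x =
      ((x * (2 * h))^2 - 4 * M^2 + 3 * (4 * M) * y * z + (4 * (4 * M) * p x + 2 * (2 * k0 + 1)) * y
        - 4 * y^2 * (p x + z) * (p x + 2 * z)) * inverse x * z
      + y * ((- (4 * M) * z^2 - (2 * (4 * M) * p x + (2 * k0 + 1)) * z + 4 * y * z * (z + p x)^2) * inverse x)
      + (h - U)"
      using inv U by algebra
    then show ?thesis
      unfolding T_def S_def hamiltonian_system_okamoto[OF rel(1)] bg_at[OF x] fA_def[OF rel(1,2)] fst_conv snd_conv
      unfolding hMU divide_inverse[of _ x]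
      by (simp add: power_mult_distrib)
  qed
qed

lemma c_alt: assumes x: "x \<in> W"
  shows "x * ei / 2 + x * (deriv p x - 2 * e0) / (4 * (p x)^2) + (2 * k0 + 1) / (4 * p x) = c x"
  unfolding bg_m_def field_inverse using right_inverse[OF p_nonzero[OF x]] by algebra

text \<open>For the converse direction y is recovered as (z3 - c)/z, so z must not vanish; its
  derivative follows from that of z by the quotient rule.\<close>

lemma solves_okamoto_iff:
  assumes g: "\<And>x. x \<in> W \<Longrightarrow> g x = - ei * ki"
    and z: "\<And>x. x \<in> W \<Longrightarrow> z x \<noteq> 0" and y3: "\<And>x. x \<in> W \<Longrightarrow> y3 x = z x + p x"
    and z3: "\<And>x. x \<in> W \<Longrightarrow> z3 x = y x * z x + c x"
  shows "solves (hamiltonian_system (okamoto_hamiltonian e0 ei k0 ki)) W y3 z3 \<longleftrightarrow>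
    solves (bg_system e0 ei k0 p) W y z"
proof
  let ?S = "bg_system e0 ei k0 p" and ?T = "hamiltonian_system (okamoto_hamiltonian e0 ei k0 ki)"
  note eqs = okamoto_bg[OF _ g]
  {
    assume S: "solves ?S W y z"
    show "solves ?T W y3 z3"
      unfolding solves_def
    proof (intro ballI conjI)
      fix x assume x: "x \<in> W"
      have y: "(y has_field_derivative fst (?S x (y x) (z x))) (at x)"
        and z: "(z has_field_derivative snd (?S x (y x) (z x))) (at x)"
        using S x unfolding solves_def by auto
      have "((\<lambda>x. z x + p x) has_field_derivative fst (?T x (y3 x) (z3 x))) (at x)"
        unfolding y3[OF x] z3[OF x] eqs(1)[OF x x] by (intro derivative_intros z p_deriv x)
      then show "(y3 has_field_derivative fst (?T x (y3 x) (z3 x))) (at x)"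
        by (rule has_field_derivative_transform_within_open[OF _ W x]) (simp add: y3)
      have "((\<lambda>x. y x * z x + c x) has_field_derivative snd (?T x (y3 x) (z3 x))) (at x)"
        unfolding y3[OF x] z3[OF x] eqs(2)[OF x x]
        by (rule derivative_eq_intros y z c_deriv x refl)+ (simp add: algebra_simps)
      then show "(z3 has_field_derivative snd (?T x (y3 x) (z3 x))) (at x)"
        by (rule has_field_derivative_transform_within_open[OF _ W x]) (simp add: z3)
    qed
  next
    assume T: "solves ?T W y3 z3"
    show "solves ?S W y z"
      unfolding solves_def
    proof (intro ballI conjI)
      fix x assume x: "x \<in> W"
      have y3': "(y3 has_field_derivative snd (?S x (y x) (z x)) + deriv p x) (at x)"
        and z3': "(z3 has_field_derivative fst (?S x (y x) (z x)) * z x + y x * snd (?S x (y x) (z x))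
            + (ei / 2 - deriv m x / 4)) (at x)"
        using T[unfolded solves_def, rule_format, OF x]
        unfolding y3[OF x] z3[OF x] eqs(1)[OF x x] eqs(2)[OF x x] by (rule conjunct1, rule conjunct2)
      have "((\<lambda>x. y3 x - p x) has_field_derivative snd (?S x (y x) (z x))) (at x)"
        by (rule derivative_eq_intros y3' p_deriv x refl)+ simp
      then show zd: "(z has_field_derivative snd (?S x (y x) (z x))) (at x)"
        by (rule has_field_derivative_transform_within_open[OF _ W x]) (simp add: y3)
      have "((\<lambda>x. (z3 x - c x) / z x) has_field_derivative fst (?S x (y x) (z x))) (at x)"
        by (rule derivative_eq_intros z3' zd c_deriv x refl z)+
           (use z[OF x] in \<open>simp add: z3[OF x] field_simps\<close>)
      then show "(y has_field_derivative fst (?S x (y x) (z x))) (at x)"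
        by (rule has_field_derivative_transform_within_open[OF _ W x]) (use z in \<open>simp add: z3\<close>)
    qed
  }
qed

end

section \<open>Coefficients\<close>

lemma dp_eval_meromorphic:
  assumes "open D" "q meromorphic_on D"
  shows "(\<lambda>x. dp_eval E q x) meromorphic_on D"
proof (induction E)
  case (Der n)
  have "(deriv ^^ n) q meromorphic_on D"
    by (induction n) (auto intro: meromorphic_on_deriv assms)
  then show ?case by simp
qed (auto intro!: meromorphic_intros)

lemma dr_eval_meromorphic:
  assumes "open D" "q meromorphic_on D"
  shows "(\<lambda>x. dr_eval r q x) meromorphic_on D"
  unfolding dr_eval_def by (intro meromorphic_intros dp_eval_meromorphic assms)

text \<open>The right-hand sides are polynomial in (y, z), so the common denominator is the constant
  polynomial 1.\<close>

definition unit_coeff :: "nat \<Rightarrow> nat \<Rightarrow> diff_poly \<times> diff_poly" where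
  "unit_coeff i j = (if (i, j) = (0, 0) then (Const 1, Const 1) else (Const 0, Const 1))"

text \<open>This is m p^2, which clears the denominator of m so that the coefficients below are
  quotients by monomials in x and p.\<close>

definition m_numerator where
  "m_numerator e0 k0 = Indep \<otimes>\<otimes> (Const (2 * e0) \<ominus>\<ominus> Der 1) \<ominus>\<ominus> Const (2 * k0 + 1) \<otimes>\<otimes> Der 0"

definition P_coeff :: "complex \<Rightarrow> complex \<Rightarrow> complex \<Rightarrow> nat \<Rightarrow> nat \<Rightarrow> diff_poly \<times> diff_poly" where
  "P_coeff e0 ei k0 i j =
    (let U = m_numerator e0 k0; p = Der 0 in
     if (i, j) = (0, 0) then
       (Const (4 * ei^2) \<otimes>\<otimes> Indep \<otimes>\<otimes> Indep \<otimes>\<otimes> p \<otimes>\<otimes> p \<otimes>\<otimes> p \<otimes>\<otimes> p \<ominus>\<ominus> U \<otimes>\<otimes> U, Const 4 \<otimes>\<otimes> Indep \<otimes>\<otimes> p \<otimes>\<otimes> p \<otimes>\<otimes> p \<otimes>\<otimes> p)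
     else if (i, j) = (1, 0) then (Const 4 \<otimes>\<otimes> U \<oplus>\<oplus> Const (2 * (2 * k0 + 1)) \<otimes>\<otimes> p, Indep \<otimes>\<otimes> p)
     else if (i, j) = (1, 1) then (Const 3 \<otimes>\<otimes> U, Indep \<otimes>\<otimes> p \<otimes>\<otimes> p)
     else if (i, j) = (2, 0) then (Const (- 4) \<otimes>\<otimes> p \<otimes>\<otimes> p, Indep)
     else if (i, j) = (2, 1) then (Const (- 12) \<otimes>\<otimes> p, Indep)
     else if (i, j) = (2, 2) then (Const (- 8), Indep)
     else (Const 0, Const 1))"

definition Q_coeff :: "complex \<Rightarrow> complex \<Rightarrow> nat \<Rightarrow> nat \<Rightarrow> diff_poly \<times> diff_poly" where
  "Q_coeff e0 k0 i j =
    (let U = m_numerator e0 k0; p = Der 0 in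
     if (i, j) = (0, 1) then (Const (- 2) \<otimes>\<otimes> U \<ominus>\<ominus> Const (2 * k0 + 1) \<otimes>\<otimes> p, Indep \<otimes>\<otimes> p)
     else if (i, j) = (0, 2) then (Const (- 1) \<otimes>\<otimes> U, Indep \<otimes>\<otimes> p \<otimes>\<otimes> p)
     else if (i, j) = (1, 1) then (Const 4 \<otimes>\<otimes> p \<otimes>\<otimes> p, Indep)
     else if (i, j) = (1, 2) then (Const 8 \<otimes>\<otimes> p, Indep)
     else if (i, j) = (1, 3) then (Const 4, Indep)
     else (Const 0, Const 1))"

lemma coefficients_from_transcendentI:
  assumes D: "open D" "q meromorphic_on D"
    and "\<And>W p x i j. undetermined A W p \<Longrightarrow> x \<in> W \<Longrightarrow> dp_eval (snd (n i j)) p x \<noteq> 0"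
    and "\<And>W p x y z. undetermined A W p \<Longrightarrow> x \<in> W \<Longrightarrow>
      f p x y z = (\<Sum>i\<le>d. \<Sum>j\<le>d. dr_eval (n i j) p x * y ^ i * z ^ j)"
  shows "coefficients_from_transcendent A D q f"
  unfolding coefficients_from_transcendent_def
proof (rule exI[of _ d], rule exI[of _ n], rule exI[of _ unit_coeff],
    intro conjI allI impI dr_eval_meromorphic D)
  have u: "dr_eval (unit_coeff i j) p x = (if j = 0 then if i = 0 then 1 else 0 else 0)" for i j p x
    by (simp add: unit_coeff_def dr_eval_def)
  have sum: "(\<Sum>i\<le>d. \<Sum>j\<le>d. dr_eval (unit_coeff i j) p x * y ^ i * z ^ j) = 1" for p x y z
  proof -
    have "(\<Sum>i\<le>d. \<Sum>j\<le>d. dr_eval (unit_coeff i j) p x * y ^ i * z ^ j) =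
        (\<Sum>i\<le>d. \<Sum>j\<le>d. if j = 0 then if i = 0 then 1 else 0 else 0)"
      unfolding u by (intro sum.cong refl) auto
    also have "\<dots> = (\<Sum>i\<le>d. if i = 0 then 1 else 0)" by (intro sum.cong refl) (subst sum.delta, auto)
    also have "\<dots> = 1" by (subst sum.delta) auto
    finally show ?thesis .
  qed
  fix W p x assume Wpx: "undetermined A W p \<and> x \<in> W"
  show "\<exists>i\<le>d. \<exists>j\<le>d. dr_eval (unit_coeff i j) p x \<noteq> 0"
    by (intro exI[of _ 0] conjI) (simp_all add: u)
  show "dp_eval (snd (unit_coeff i j)) p x \<noteq> 0" for i j by (simp add: unit_coeff_def)
  show "dp_eval (snd (n i j)) p x \<noteq> 0" for i j using Wpx assms(3) by blast
  fix y z
  show "f p x y z = (\<Sum>i\<le>d. \<Sum>j\<le>d. dr_eval (n i j) p x * y ^ i * z ^ j) /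
      (\<Sum>i\<le>d. \<Sum>j\<le>d. dr_eval (unit_coeff i j) p x * y ^ i * z ^ j)"
    using Wpx assms(4)[of W p x y z] by (simp add: sum)
qed

lemma undetermined_P3D6_nonzero:
  assumes "undetermined P3D6_dom W p" "x \<in> W" shows "x \<noteq> 0" "p x \<noteq> 0"
  using assms by (auto simp: undetermined_def P3D6_dom_def)

lemma coefficients_P:
  assumes "open D" "q meromorphic_on D"
  shows "coefficients_from_transcendent P3D6_dom D q (\<lambda>p x y z. fst (bg_system e0 ei k0 p x y z))"
proof (rule coefficients_from_transcendentI[OF assms, where d = 2 and n = "P_coeff e0 ei k0"])
  fix W p x assume u: "undetermined P3D6_dom W p" "x \<in> W"
  note nz = undetermined_P3D6_nonzero[OF u]
  show "dp_eval (snd (P_coeff e0 ei k0 i j)) p x \<noteq> 0" for i j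
    using nz by (simp add: P_coeff_def Let_def)
  have U: "dp_eval (m_numerator e0 k0) p x = bg_m e0 k0 p x * (p x)^2"
    using nz by (simp add: m_numerator_def bg_m_def)
  fix y z
  show "fst (bg_system e0 ei k0 p x y z) = (\<Sum>i\<le>2. \<Sum>j\<le>2. dr_eval (P_coeff e0 ei k0 i j) p x * y ^ i * z ^ j)"
    unfolding bg_system_at[where x = x and p = p, OF nz] fA_def[OF nz] fst_conv
    apply (simp add: numeral_2_eq_2 P_coeff_def Let_def dr_eval_def U)
    unfolding field_inverse
    using right_inverse[OF nz(1)] right_inverse[OF nz(2)] apply algebra
    done
qed

lemma coefficients_Q:
  assumes "open D" "q meromorphic_on D"
  shows "coefficients_from_transcendent P3D6_dom D q (\<lambda>p x y z. snd (bg_system e0 ei k0 p x y z))"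
proof (rule coefficients_from_transcendentI[OF assms, where d = 3 and n = "Q_coeff e0 k0"])
  fix W p x assume u: "undetermined P3D6_dom W p" "x \<in> W"
  note nz = undetermined_P3D6_nonzero[OF u]
  show "dp_eval (snd (Q_coeff e0 k0 i j)) p x \<noteq> 0" for i j
    using nz by (simp add: Q_coeff_def Let_def)
  have U: "dp_eval (m_numerator e0 k0) p x = bg_m e0 k0 p x * (p x)^2"
    using nz by (simp add: m_numerator_def bg_m_def)
  fix y z
  show "snd (bg_system e0 ei k0 p x y z) = (\<Sum>i\<le>3. \<Sum>j\<le>3. dr_eval (Q_coeff e0 k0 i j) p x * y ^ i * z ^ j)"
    unfolding bg_system_at[where x = x and p = p, OF nz] fA_def[OF nz] snd_conv
    apply (simp add: numeral_3_eq_3 numeral_2_eq_2 Q_coeff_def Let_def dr_eval_def U)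
    unfolding field_inverse
    using right_inverse[OF nz(1)] right_inverse[OF nz(2)] apply algebra
    done
qed

section \<open>The theorem\<close>

lemma holomorphic_coeff_pCons:
  assumes "\<And>i. (\<lambda>x. coeff (f x) i) holomorphic_on D" "\<And>j i. (\<lambda>x. coeff (coeff (h x) j) i) holomorphic_on D"
  shows "(\<lambda>x. coeff (coeff (pCons (f x) (h x)) j) i) holomorphic_on D"
  using assms by (cases j) simp_all

lemma holomorphic_coeff_linear:
  assumes "f holomorphic_on D"
  shows "(\<lambda>x. coeff [:f x:] i) holomorphic_on D" "(\<lambda>x. coeff [:f x, c:] i) holomorphic_on D"
  using assms by (cases i; simp)+

section \<open>The case of a solution q on its regular set\<close>

locale P3_solution =
  fixes e0 ei k0 ki :: complex and D :: "complex set" and q :: "complex \<Rightarrow> complex"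
  assumes e0: "e0 \<noteq> 0" and ei: "ei \<noteq> 0" and sol: "solution_of P3D6_dom
    (P3D6_rhs (- 4 * ei * ki) (4 * e0 * (k0 + 1)) (4 * ei^2) (- 4 * e0^2)) D q"
begin

abbreviation "D' \<equiv> regular_set P3D6_dom D q"
abbreviation "BG \<equiv> bg_system e0 ei k0 q"
abbreviation "Ham \<equiv> hamiltonian_system (okamoto_hamiltonian e0 ei k0 ki)"
abbreviation "shift x \<equiv> x * ei / 2 - bg_m e0 k0 q x / 4"

lemma regular:
  assumes "x \<in> D'"
  shows "x \<noteq> 0" "q x \<noteq> 0" "q analytic_on {x}"
    "deriv (deriv q) x = P3D6_rhs (- 4 * ei * ki) (4 * e0 * (k0 + 1)) (4 * ei^2) (- 4 * e0^2) x (q x) (deriv q x)"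
  using assms sol unfolding regular_set_def P3D6_dom_def solution_of_def by auto

lemma q_analytic: "q analytic_on D'"
  using regular(3) analytic_on_analytic_at by blast

lemma shift_analytic: "shift analytic_on D'"
  unfolding bg_m_def
  by (intro analytic_intros q_analytic analytic_deriv) (use regular(2) in auto)

lemma undetermined_function: "open W \<Longrightarrow> W \<subseteq> D' \<Longrightarrow> undetermined_function e0 ei W q"
  using e0 ei regular(1,2) analytic_imp_holomorphic[OF analytic_on_subset[OF q_analytic]]
  unfolding undetermined_function_def by blast

lemma solves_iff:
  assumes open_W: "open W" and WD: "W \<subseteq> D'"
    and "\<And>x. x \<in> W \<Longrightarrow> z x \<noteq> 0 \<and> y3 x = z x + q x \<and> z3 x = y x * z x + shift x"
  shows "solves Ham W y3 z3 \<longleftrightarrow> solves BG W y z"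
proof -
  interpret undetermined_function e0 ei k0 W q by (rule undetermined_function[OF open_W WD])
  have "\<forall>x\<in>W. deriv (deriv q) x =
      P3D6_rhs (- 4 * ei * ki) (4 * e0 * (k0 + 1)) (4 * ei^2) (- 4 * e0^2) x (q x) (deriv q x)"
    using regular(4) WD by blast
  note g = g_P3(1)[OF this]
  show ?thesis by (rule solves_okamoto_iff[OF g]) (use assms(3) in auto)
qed

text \<open>The inverse is z = y3 - q, y = (z3 - shift)/(y3 - q). The exceptional curves are z = 0
  on one side and y3 = q on the other.\<close>

lemma birationally_equivalent: "birationally_equivalent D' BG Ham"
proof -
  define \<Phi> :: planar_system where "\<Phi> x y z = (z + q x, y * z + shift x)" for x y z
  define \<Psi> :: planar_system where "\<Psi> x y z = ((z - shift x) / (y - q x), y - q x)" for x y z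
  define E :: "complex \<Rightarrow> complex poly poly" where "E x = [:0, 1:]" for x
  define F :: "complex \<Rightarrow> complex poly poly" where "F x = [:[:- q x, 1:]:]" for x
  have E: "eval2 (E x) y z = z" and F: "eval2 (F x) y z = y - q x" for x y z
    by (simp_all add: E_def F_def eval2_def)
  have holo: "q holomorphic_on D'" "shift holomorphic_on D'"
    using q_analytic shift_analytic analytic_imp_holomorphic by blast+
  have "rational_transformation D' \<Phi>"
    unfolding rational_transformation_def
  proof (rule exI[of _ "\<lambda>x. [:[:q x:], 1:]"], rule exI[of _ "\<lambda>x. 1"],
      rule exI[of _ "\<lambda>x. [:[:shift x:], [:0, 1:]:]"], rule exI[of _ "\<lambda>x. 1"], intro conjI)
    show "\<forall>K\<in>{\<lambda>x. [:[:q x:], 1:], \<lambda>x. 1, \<lambda>x. [:[:shift x:], [:0, 1:]:], \<lambda>x. 1}.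
        \<forall>i j. (\<lambda>x. coeff (coeff (K x) j) i) holomorphic_on D'"
      using holo by (auto simp del: coeff_pCons_Suc intro!: holomorphic_coeff_pCons holomorphic_coeff_linear holomorphic_on_const)
  qed (auto simp: \<Phi>_def eval2_def)
  moreover have "rational_transformation D' \<Psi>"
    unfolding rational_transformation_def
  proof (rule exI[of _ "\<lambda>x. [:[:- shift x:], 1:]"], rule exI[of _ F], rule exI[of _ F],
      rule exI[of _ "\<lambda>x. 1"], intro conjI)
    show "\<forall>K\<in>{\<lambda>x. [:[:- shift x:], 1:], F, F, \<lambda>x. 1}.
        \<forall>i j. (\<lambda>x. coeff (coeff (K x) j) i) holomorphic_on D'"
      unfolding F_def using holo holomorphic_on_minus[OF holo(2)]
      by (auto intro!: holomorphic_coeff_pCons holomorphic_coeff_linear holomorphic_on_minus holomorphic_on_const)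
  qed (auto simp: \<Psi>_def F_def eval2_def)
  moreover have "transforms_into D' \<Phi> E BG Ham"
    unfolding transforms_into_def
  proof (intro allI impI, elim conjE)
    fix W y z assume W: "open W" "W \<subseteq> D'" and nz: "\<forall>x\<in>W. eval2 (E x) (y x) (z x) \<noteq> 0"
      and S: "solves BG W y z"
    show "solves Ham W (\<lambda>x. fst (\<Phi> x (y x) (z x))) (\<lambda>x. snd (\<Phi> x (y x) (z x)))"
      using S solves_iff[OF W(1,2), of z "\<lambda>x. fst (\<Phi> x (y x) (z x))" "\<lambda>x. snd (\<Phi> x (y x) (z x))" y] nz
      by (simp add: E \<Phi>_def)
  qed
  moreover have "transforms_into D' \<Psi> F Ham BG"
    unfolding transforms_into_def
  proof (intro allI impI, elim conjE)
    fix W y z assume W: "open W" "W \<subseteq> D'" and nz: "\<forall>x\<in>W. eval2 (F x) (y x) (z x) \<noteq> 0"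
      and T: "solves Ham W y z"
    show "solves BG W (\<lambda>x. fst (\<Psi> x (y x) (z x))) (\<lambda>x. snd (\<Psi> x (y x) (z x)))"
      using T solves_iff[OF W(1,2), of "\<lambda>x. snd (\<Psi> x (y x) (z x))" y z "\<lambda>x. fst (\<Psi> x (y x) (z x))"] nz
      by (simp add: F \<Psi>_def)
  qed
  moreover have "(case \<Phi> x y z of (y3, z3) \<Rightarrow> \<Psi> x y3 z3) = (y, z)" if "eval2 (E x) y z \<noteq> 0" for x y z
    using that by (simp add: E \<Phi>_def \<Psi>_def)
  moreover have "(case \<Psi> x y z of (y1, z1) \<Rightarrow> \<Phi> x y1 z1) = (y, z)" if "eval2 (F x) y z \<noteq> 0" for x y z
    using that by (simp add: F \<Phi>_def \<Psi>_def)
  moreover have "E x \<noteq> 0 \<and> F x \<noteq> 0" for x by (simp add: E_def F_def)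
  ultimately show ?thesis
    unfolding birationally_equivalent_def
    by (intro exI[of _ \<Phi>] exI[of _ \<Psi>] exI[of _ E] exI[of _ F]) blast
qed

lemma bureau_guillot_bg:
  "bureau_guillot P3D6_dom
    (P3D6_rhs (- 4 * ei * ki) (4 * e0 * (k0 + 1)) (4 * ei^2) (- 4 * e0^2)) Ham (bg_system e0 ei k0) D q"
  using sol birationally_equivalent obtained_as_regularising_condition_bg[OF e0 ei]
  unfolding bureau_guillot_def solution_of_def by (blast intro: coefficients_P coefficients_Q)

end

theorem proposition3p1:
  fixes e0 ei k0 ki :: complex and D :: "complex set" and q :: "complex \<Rightarrow> complex"
  defines "R \<equiv> P3D6_rhs (- 4 * ei * ki) (4 * e0 * (k0 + 1)) (4 * ei\<^sup>2) (- 4 * e0\<^sup>2)"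
    and "T \<equiv> hamiltonian_system (okamoto_hamiltonian e0 ei k0 ki)"
  assumes "e0 * ei \<noteq> 0"
    and "solution_of P3D6_dom R D q"
  shows "(\<forall>W y z y3 z3.
            open W \<and> W \<subseteq> regular_set P3D6_dom D q \<and>
            (\<forall>x\<in>W. z x \<noteq> 0 \<and>
               y3 x = z x + q x \<and>
               z3 x = y x * z x + x * ei / 2 + x * (deriv q x - 2 * e0) / (4 * (q x)\<^sup>2)
                      + (2 * k0 + 1) / (4 * q x)) \<longrightarrow>
            (solves T W y3 z3 \<longleftrightarrow> solves (bg_system e0 ei k0 q) W y z)) \<and>
         bureau_guillot P3D6_dom R T (bg_system e0 ei k0) D q"
proof (intro conjI allI impI)
  interpret P3_solution e0 ei k0 ki D q
    using assms by (simp add: P3_solution_def)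
  show "bureau_guillot P3D6_dom R T (bg_system e0 ei k0) D q"
    unfolding R_def T_def by (rule bureau_guillot_bg)
  fix W y z y3 z3
  assume *: "open W \<and> W \<subseteq> regular_set P3D6_dom D q \<and>
    (\<forall>x\<in>W. z x \<noteq> 0 \<and> y3 x = z x + q x \<and>
       z3 x = y x * z x + x * ei / 2 + x * (deriv q x - 2 * e0) / (4 * (q x)\<^sup>2) + (2 * k0 + 1) / (4 * q x))"
  then interpret undetermined_function e0 ei k0 W q using undetermined_function by blast
  show "solves T W y3 z3 \<longleftrightarrow> solves (bg_system e0 ei k0 q) W y z"
    \<comment> \<open>\<open>c_alt\<close> identifies the explicit summands of z3 in the theorem
      with the shift by e/2 - m/4.\<close>
    unfolding T_def by (rule solves_iff) (use * in \<open>auto simp flip: c_alt simp: add.assoc\<close>)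
qed

end
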